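(* The Decomposition Algorithm described in the context converges to an optimal solution of Problem (E) (defined in the context) in finitely many iterations.
   Context: **Data.** $N$ is a set of nodes (bus stops), $H\subseteq N$ a set of hubs, $T$ the set of trips, $T'\subseteq T$ the trips with mode choice. Each trip $r\in T$ has an origin $or^r\in N$, a destination $de^r\in N$, and a number of riders $p^r\in\mathbb Z_{+}$. For $i,j\in N$, $t_{ij}$ and $d_{ij}$ are travel time and distance (possibly asymmetric), assumed to satisfy the triangle inequality. $\theta\in[0,1]$ is a weight, $g$ the shuttle cost per mile, $s$ the average waiting time of a bus, $\rho$ the bus cost per mile, $n$ the number of buses per open leg, $\phi$ the ticket price. Put $\varphi=(1-\theta)\phi$, $\beta_{hl}=(1-\theta)\rho\, n\, d_{hl}$, $\gamma^r_{ij}=(1-\theta)g\,d_{ij}+\theta t_{ij}$, $\tau^r_{hl}=\theta(t_{hl}+s)$. For $r\in T'$, $\alpha^r$ is a parameter of the rider and $t^r_{cur}$ is her direct trip duration with her personal vehicle. $A^r$ is the set of shuttle arcs $(or^r,h)$ and $(h,de^r)$ for $h\in H$, and $(or^r,de^r)$; by the triangle inequality only these shuttle arcs need to be considered. **Follower problem** of trip $r$ for a given design $\mathbf z\in\{0,1\}^{|H|\times|H|}$: lexicographically minimize $\langle b^r,f^r\rangle$ (first $b^r$, then $f^r$) over binary $x^r_{hl}$ ($h,l\in H$) and $y^r_{ij}$ ($(i,j)\in A^r$), where $b^r=\sum\tau^r_{hl}x^r_{hl}+\sum\gamma^r_{ij}y^r_{ij}$ and $f^r=\sum(t_{hl}+s)x^r_{hl}+\sum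 t_{ij}y^r_{ij}$, subject to $x^r_{hl}\le z_{hl}$ and unit flow conservation from $or^r$ to $de^r$ (net outflow $1$ at $or^r$, $-1$ at $de^r$, $0$ at every other node, counting both bus legs $x$ and shuttle legs $y$). The optimal value $({b^r}^*,{f^r}^* )$ is unique for given $\mathbf z$. An optimal solution is the optimal route of $r$, with time ${f^r}^*$. **Choice function:** ${\cal C}^r(\mathbf z)=1$ if ${f^r}^*\le\alpha^rt^r_{cur}$ (the rider "adopts"), else $0$. **Scaled dual subproblem.** Let $M$ be a suitably large constant, so that the follower problem can be solved as a linear program with objective $Mb^r+f^r$, and put $\hat\tau^r_{hl}=M\tau^r_{hl}+t_{hl}+s$, $\hat\gamma^r_{ij}=M\gamma^r_{ij}+t_{ij}$. For a design $\bar{\mathbf z}$, the dual subproblem of trip $r$ is to maximize $(u^r_{or^r}-u^r_{de^r})-\sum_{h,l\in H}\bar z_{hl}v^r_{hl}$ over the polyhedron $D^r$ of all $(u^r,v^r)$ with $u^r_h-u^r_l-v^r_{hl}\le\hat\tau^r_{hl}$ for all $h,l\in H$, $u^r_i-u^r_j\le\hat\gamma^r_{ij}$ for all $(i,j)\in A^r$, $u^r_i\ge0$ for all $i\in N$, and $v^r_{hl}\ge0$ for all $h,l\in H$. **Problem (E).** Minimize $\sum_{h,l\in H}\beta_{hl}z_{hl}+\sum_{r\in T\setminus T'}p^rb^r+\sum_{r\in T'}p^r\delta^r(b^r-\varphi)$ over $\mathbf z,\boldsymbol\delta$ and real $b^r$ ($r\in T$), subject to $\sum_{l\in H}z_{hl}=\sum_{l\in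 H}z_{lh}$ for all $h\in H$ (weak connectivity), $z_{hl},\delta^r\in\{0,1\}$, and all cuts: - (N0) for $r\in T'$ and each design $\bar{\mathbf z}$ with ${\cal C}^r(\bar{\mathbf z})=0$: $\sum_{(h,l):\bar z_{hl}=0}z_{hl}+\sum_{(h,l):\bar z_{hl}=1}(1-z_{hl})\ge\delta^r$; - (N1) for $r\in T'$ and each design $\bar{\mathbf z}$ with ${\cal C}^r(\bar{\mathbf z})=1$: $\sum_{(h,l):\bar z_{hl}=0}z_{hl}+\sum_{(h,l):\bar z_{hl}=1}(1-z_{hl})+\delta^r\ge1$; - (O) for $r\in T$ and each vertex $(\bar u^r,\bar v^r)$ of $D^r$: $b^r\ge(\bar u^r_{or^r}-\bar u^r_{de^r})-\sum_{h,l\in H}z_{hl}\bar v^r_{hl}$. **Relaxed master problem (initial).** Minimize $\sum_{h,l\in H}\beta_{hl}z_{hl}+\sum_{r\in T\setminus T'}p^rb^r+\sum_{r\in T'}p^r(\nu^r-\delta^r\varphi)$ subject to weak connectivity, $z_{hl},\delta^r\in\{0,1\}$, and, for $r\in T'$, $\nu^r\le M^r\delta^r$, $\nu^r\le b^r$, $\nu^r\ge b^r-M^r(1-\delta^r)$, $\nu^r\ge0$, where $M^r$ is an upper bound on the value of $b^r$. **Decomposition Algorithm.** $\epsilon$ is the stopping tolerance. Start with $LB=-\infty$, $UB=\infty$, $z^*=\emptyset$. While $UB>LB+\epsilon$: 1. Solve the relaxed master problem; obtain $\bar{\mathbf z},\bar{\boldsymbol\delta},\bar{\mathbf b}$; update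 $LB$ (with the optimal value of the relaxed master problem). 2. For every $r\in T$, solve the scaled dual subproblem under $\bar{\mathbf z}$, obtain $({b^r}^*,{f^r}^* )$, and add to the relaxed master problem the cut (O) given by its optimal (vertex) solution $(\bar u^r,\bar v^r)$. 3. For every $r\in T'$: if $\bar\delta^r\neq{\cal C}^r(\bar{\mathbf z})$, add the cut (N0) or (N1) (whichever applies) for $\bar{\mathbf z}$; add those of the inequalities (V1)–(V5) below, taken with $\mathbf z^1=\bar{\mathbf z}$, whose conditions hold; set $\hat\delta^r={\cal C}^r(\bar{\mathbf z})$. 4. Let $\widehat{UB}=\sum_{h,l\in H}\beta_{hl}\bar z_{hl}+\sum_{r\in T\setminus T'}p^r{b^r}^*+\sum_{r\in T'}p^r\hat\delta^r({b^r}^*-\varphi)$. If $\widehat{UB}<UB$, set $UB=\widehat{UB}$ and $z^*=\bar{\mathbf z}$. **Inequalities (V1)–(V5)** for a trip $r\in T'$ whose origin and destination are not hubs, and a design $\mathbf z^1$. Let $t^1$ be the time of the optimal route under $\mathbf z^1$, which is either a direct shuttle trip or consists of a shuttle from $or^r$ to some hub $m$, bus legs, and a shuttle from some hub $n$ to $de^r$ (a "hub route"). Let $D^-=\min_{h,l\in H}\{d_{or^rh}+d_{lde^r}\}$ and $D^+=\max\{\max_{h,l\in H}\{d_{or^rh}+d_{lde^r}\},d_{or^rde^r}\}$. For a hub route: $UB^r=t^1+\frac{1-\theta}{\theta}g(d_{or^rm}+d_{nde^r}-D^-)$, $LB^r=t^1+\frac{1-\theta}{\theta}g(d_{or^rm}+d_{nde^r}-D^+)$.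 For a direct route: $UB^r=\max\{t^1,t^1+\frac{1-\theta}{\theta}g(d_{or^rde^r}-D^-)\}$, $LB^r=t^1$. Let $\mathcal H(\mathbf z^1)=\{h\in H:\sum_{l\in H}z^1_{hl}>0\}$ (active hubs); let $\overrightarrow W$ be the set of non-active hubs $h$ with $d_{or^rh}<\min_{h'\in\mathcal H(\mathbf z^1)}d_{or^rh'}$ and $\overleftarrow W$ the set of non-active hubs $h$ with $d_{hde^r}<\min_{h'\in\mathcal H(\mathbf z^1)}d_{h'de^r}$. Let $\mathcal A^r(\mathbf z^1)$ be the set of bus legs $(h,l)$ used by the optimal route of $r$ under $\mathbf z^1$. - (V1) if $r$ adopts under $\mathbf z^1$ and $UB^r\le\alpha^rt^r_{cur}$: $\sum_{(h,l):z^1_{hl}=1}(1-z_{hl})+\delta^r\ge1$. - (V2) if $r$ does not adopt under $\mathbf z^1$ and $LB^r\ge\alpha^rt^r_{cur}$: $\sum_{(h,l):z^1_{hl}=0}z_{hl}\ge\delta^r$. - (V3) if $r$ adopts under $\mathbf z^1$ with a hub route for which $m$ and $n$ are the closest active hubs to the origin and destination: $\sum_{h\in\overrightarrow W\cup\overleftarrow W,\,l\in H}z_{hl}+\sum_{(h,l):z^1_{hl}=1}(1-z_{hl})+\delta^r\ge1$. - (V4) if $r$ adopts under $\mathbf z^1$: $\sum_{(h,l)\in\mathcal A^r(\mathbf z^1)}(1-z_{hl})+\sum_{(h,l):z^1_{hl}=0}z_{hl}+\delta^r\ge1$. - (V5) if $r$ does not adopt under $\mathbf z^1$: $\sum_{(h,l)\in\mathcal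 A^r(\mathbf z^1)}(1-z_{hl})+\sum_{(h,l):z^1_{hl}=0}z_{hl}\ge\delta^r$.
   Formalization: In step 4 the value b^{r*} is read as the scaled optimum M b^{r*} + f^{r*}, since (E) bounds b^r by scaled dual values and the unscaled bound can return a non-optimal design; optimality is exact for small tolerance and within ε for every ε ≥ 0. *)

theory Defs
  imports "HOL-Analysis.Analysis"
begin

text \<open>The node set is the finite type \<open>'n\<close>. Matrices indexed by pairs of hubs
  are represented by functions on all pairs of nodes that vanish outside \<open>H \<times> H\<close>
  (likewise for shuttle variables outside the admissible arcs), so that a design is determined by
  its entries in \<open>H \<times> H\<close> and the dual polyhedron lives in a Euclidean space.\<close>

record ('n, 't) transit =
  hubs :: "'n set"
  trips :: "'t set"
  mode_trips :: "'t set"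
  orig :: "'t \<Rightarrow> 'n"
  dest :: "'t \<Rightarrow> 'n"
  riders :: "'t \<Rightarrow> nat"
  ttime :: "'n \<Rightarrow> 'n \<Rightarrow> real"
  tdist :: "'n \<Rightarrow> 'n \<Rightarrow> real"
  weight :: real
  shuttle_cost :: real
  bus_wait :: real
  bus_cost :: real
  buses :: nat
  ticket :: real
  patience :: "'t \<Rightarrow> real" \<comment> \<open>the parameter \<open>\<alpha>\<close> of the rider\<close>
  cur_time :: "'t \<Rightarrow> real"
  bigM :: real
  bigMr :: "'t \<Rightarrow> real"

definition valid_data :: "('n::finite, 't) transit \<Rightarrow> bool" where
  "valid_data I \<longleftrightarrow>
     finite (trips I) \<and> mode_trips I \<subseteq> trips I \<and>
     (\<forall>r\<in>trips I. orig I r \<noteq> dest I r) \<and>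
     (\<forall>i j. 0 \<le> ttime I i j) \<and> (\<forall>i j. 0 \<le> tdist I i j) \<and>
     (\<forall>i j k. ttime I i k \<le> ttime I i j + ttime I j k) \<and>
     (\<forall>i j k. tdist I i k \<le> tdist I i j + tdist I j k) \<and>
     0 \<le> weight I \<and> weight I \<le> 1 \<and>
     0 \<le> shuttle_cost I \<and> 0 \<le> bus_wait I"

definition net_price :: "('n, 't) transit \<Rightarrow> real" where
  "net_price I = (1 - weight I) * ticket I"

definition beta :: "('n, 't) transit \<Rightarrow> 'n \<Rightarrow> 'n \<Rightarrow> real" where
  "beta I h l = (1 - weight I) * bus_cost I * real (buses I) * tdist I h l"

definition gamma :: "('n, 't) transit \<Rightarrow> 'n \<Rightarrow> 'n \<Rightarrow> real" where
  "gamma I i j = (1 - weight I) * shuttle_cost I * tdist I i j + weight I * ttime I i j"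

definition tau :: "('n, 't) transit \<Rightarrow> 'n \<Rightarrow> 'n \<Rightarrow> real" where
  "tau I h l = weight I * (ttime I h l + bus_wait I)"

definition shuttle_arcs :: "('n, 't) transit \<Rightarrow> 't \<Rightarrow> ('n \<times> 'n) set" where
  "shuttle_arcs I r =
     (\<lambda>h. (orig I r, h)) ` hubs I \<union> (\<lambda>h. (h, dest I r)) ` hubs I \<union> {(orig I r, dest I r)}"

type_synonym 'n mat = "'n \<Rightarrow> 'n \<Rightarrow> real"
type_synonym 'n route = "'n mat \<times> 'n mat"

definition designs :: "('n, 't) transit \<Rightarrow> 'n mat set" where
  "designs I = {z. \<forall>h l. if h \<in> hubs I \<and> l \<in> hubs I then z h l \<in> {0, 1} else z h l = 0}"

definition weakly_connected :: "('n, 't) transit \<Rightarrow> 'n mat \<Rightarrow> bool" where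
  "weakly_connected I z \<longleftrightarrow>
     (\<forall>h\<in>hubs I. (\<Sum>l\<in>hubs I. z h l) = (\<Sum>l\<in>hubs I. z l h))"

definition routes :: "('n::finite, 't) transit \<Rightarrow> 't \<Rightarrow> 'n mat \<Rightarrow> 'n route set" where
  "routes I r z = {(x, y).
     (\<forall>h l. if h \<in> hubs I \<and> l \<in> hubs I then x h l \<in> {0, 1} \<and> x h l \<le> z h l else x h l = 0) \<and>
     (\<forall>i j. if (i, j) \<in> shuttle_arcs I r then y i j \<in> {0, 1} else y i j = 0) \<and>
     (\<forall>i. (\<Sum>j\<in>UNIV. x i j + y i j) - (\<Sum>j\<in>UNIV. x j i + y j i) =
            (if i = orig I r then 1 else if i = dest I r then - 1 else 0))}"

definition route_cost :: "('n, 't) transit \<Rightarrow> 't \<Rightarrow> 'n route \<Rightarrow> real" where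
  "route_cost I r = (\<lambda>(x, y).
     (\<Sum>h\<in>hubs I. \<Sum>l\<in>hubs I. tau I h l * x h l) +
     (\<Sum>(i, j)\<in>shuttle_arcs I r. gamma I i j * y i j))"

definition route_time :: "('n, 't) transit \<Rightarrow> 't \<Rightarrow> 'n route \<Rightarrow> real" where
  "route_time I r = (\<lambda>(x, y).
     (\<Sum>h\<in>hubs I. \<Sum>l\<in>hubs I. (ttime I h l + bus_wait I) * x h l) +
     (\<Sum>(i, j)\<in>shuttle_arcs I r. ttime I i j * y i j))"

definition optimal_route ::
    "('n::finite, 't) transit \<Rightarrow> 't \<Rightarrow> 'n mat \<Rightarrow> 'n route \<Rightarrow> bool" where
  "optimal_route I r z w \<longleftrightarrow> w \<in> routes I r z \<and>
     (\<forall>w'\<in>routes I r z. route_cost I r w < route_cost I r w' \<or>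
        route_cost I r w = route_cost I r w' \<and> route_time I r w \<le> route_time I r w')"

definition bstar :: "('n::finite, 't) transit \<Rightarrow> 't \<Rightarrow> 'n mat \<Rightarrow> real" where
  "bstar I r z = (THE b. \<exists>w. optimal_route I r z w \<and> b = route_cost I r w)"

definition fstar :: "('n::finite, 't) transit \<Rightarrow> 't \<Rightarrow> 'n mat \<Rightarrow> real" where
  "fstar I r z = (THE f. \<exists>w. optimal_route I r z w \<and> f = route_time I r w)"

definition choice :: "('n::finite, 't) transit \<Rightarrow> 't \<Rightarrow> 'n mat \<Rightarrow> real" where
  "choice I r z = (if fstar I r z \<le> patience I r * cur_time I r then 1 else 0)"

definition scaling_valid :: "('n::finite, 't) transit \<Rightarrow> bool" where
  "scaling_valid I \<longleftrightarrow> 0 < bigM I \<and>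
     (\<forall>r\<in>trips I. \<forall>z\<in>designs I. \<forall>w\<in>routes I r z.
        (\<forall>w'\<in>routes I r z. bigM I * route_cost I r w + route_time I r w
                             \<le> bigM I * route_cost I r w' + route_time I r w')
        \<longrightarrow> optimal_route I r z w)"

definition tau_hat :: "('n, 't) transit \<Rightarrow> 'n \<Rightarrow> 'n \<Rightarrow> real" where
  "tau_hat I h l = bigM I * tau I h l + ttime I h l + bus_wait I"

definition gamma_hat :: "('n, 't) transit \<Rightarrow> 'n \<Rightarrow> 'n \<Rightarrow> real" where
  "gamma_hat I i j = bigM I * gamma I i j + ttime I i j"

definition dual_poly :: "('n::finite, 't) transit \<Rightarrow> 't \<Rightarrow> ((real ^ 'n) \<times> (real ^ 'n ^ 'n)) set" where
  "dual_poly I r = {(u, v).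
     (\<forall>h\<in>hubs I. \<forall>l\<in>hubs I. u $ h - u $ l - v $ h $ l \<le> tau_hat I h l) \<and>
     (\<forall>(i, j)\<in>shuttle_arcs I r. u $ i - u $ j \<le> gamma_hat I i j) \<and>
     (\<forall>i. 0 \<le> u $ i) \<and>
     (\<forall>h l. if h \<in> hubs I \<and> l \<in> hubs I then 0 \<le> v $ h $ l else v $ h $ l = 0)}"

definition dual_obj ::
    "('n::finite, 't) transit \<Rightarrow> 't \<Rightarrow> 'n mat \<Rightarrow> (real ^ 'n) \<times> (real ^ 'n ^ 'n) \<Rightarrow> real" where
  "dual_obj I r z = (\<lambda>(u, v).
     (u $ orig I r - u $ dest I r) - (\<Sum>h\<in>hubs I. \<Sum>l\<in>hubs I. z h l * v $ h $ l))"

definition optimal_dual_vertex ::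
    "('n::finite, 't) transit \<Rightarrow> 't \<Rightarrow> 'n mat \<Rightarrow> (real ^ 'n) \<times> (real ^ 'n ^ 'n) \<Rightarrow> bool" where
  "optimal_dual_vertex I r z w \<longleftrightarrow> w extreme_point_of dual_poly I r \<and>
     (\<forall>w'\<in>dual_poly I r. dual_obj I r z w' \<le> dual_obj I r z w)"

text \<open>The optimality cuts bound the variable \<open>b\<close> of a trip by objective values of the
  scaled dual subproblem. Hence \<open>b\<close> is measured in scaled units throughout, and the value
  it takes under the design \<open>z\<close> is the following.\<close>

definition scaled_value :: "('n::finite, 't) transit \<Rightarrow> 't \<Rightarrow> 'n mat \<Rightarrow> real" where
  "scaled_value I r z = bigM I * bstar I r z + fstar I r z"

definition bound_valid :: "('n::finite, 't) transit \<Rightarrow> bool" where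
  "bound_valid I \<longleftrightarrow> (\<forall>r\<in>mode_trips I. \<forall>z\<in>designs I. scaled_value I r z \<le> bigMr I r)"

text \<open>A cut is a constraint on \<open>z\<close>, \<open>\<delta>\<close> and \<open>b\<close>.\<close>

type_synonym ('n, 't) cut = "'n mat \<Rightarrow> ('t \<Rightarrow> real) \<Rightarrow> ('t \<Rightarrow> real) \<Rightarrow> bool"

definition num_opened :: "('n, 't) transit \<Rightarrow> 'n mat \<Rightarrow> 'n mat \<Rightarrow> real" where
  "num_opened I z1 z = (\<Sum>(h, l)\<in>{(h, l) \<in> hubs I \<times> hubs I. z1 h l = 0}. z h l)"

definition num_closed :: "('n, 't) transit \<Rightarrow> 'n mat \<Rightarrow> 'n mat \<Rightarrow> real" where
  "num_closed I z1 z = (\<Sum>(h, l)\<in>{(h, l) \<in> hubs I \<times> hubs I. z1 h l = 1}. 1 - z h l)"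

definition reject_cut :: "('n, 't) transit \<Rightarrow> 't \<Rightarrow> 'n mat \<Rightarrow> ('n, 't) cut" where
  "reject_cut I r z1 = (\<lambda>z \<delta> b. num_opened I z1 z + num_closed I z1 z \<ge> \<delta> r)"

definition adopt_cut :: "('n, 't) transit \<Rightarrow> 't \<Rightarrow> 'n mat \<Rightarrow> ('n, 't) cut" where
  "adopt_cut I r z1 = (\<lambda>z \<delta> b. num_opened I z1 z + num_closed I z1 z + \<delta> r \<ge> 1)"

definition choice_cut :: "('n::finite, 't) transit \<Rightarrow> 't \<Rightarrow> 'n mat \<Rightarrow> ('n, 't) cut" where
  "choice_cut I r z1 = (if choice I r z1 = 0 then reject_cut I r z1 else adopt_cut I r z1)"

definition optimality_cut ::
    "('n::finite, 't) transit \<Rightarrow> 't \<Rightarrow> (real ^ 'n) \<times> (real ^ 'n ^ 'n) \<Rightarrow> ('n, 't) cut" where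
  "optimality_cut I r w = (\<lambda>z \<delta> b. b r \<ge> dual_obj I r z w)"

definition design_cost :: "('n, 't) transit \<Rightarrow> 'n mat \<Rightarrow> real" where
  "design_cost I z = (\<Sum>h\<in>hubs I. \<Sum>l\<in>hubs I. beta I h l * z h l)"

definition E_feasible ::
    "('n::finite, 't) transit \<Rightarrow> 'n mat \<times> ('t \<Rightarrow> real) \<times> ('t \<Rightarrow> real) \<Rightarrow> bool" where
  "E_feasible I = (\<lambda>(z, \<delta>, b).
     z \<in> designs I \<and> weakly_connected I z \<and> (\<forall>r\<in>mode_trips I. \<delta> r \<in> {0, 1}) \<and>
     (\<forall>r\<in>mode_trips I. \<forall>z1\<in>designs I. choice I r z1 = 0 \<longrightarrow> reject_cut I r z1 z \<delta> b) \<and>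
     (\<forall>r\<in>mode_trips I. \<forall>z1\<in>designs I. choice I r z1 = 1 \<longrightarrow> adopt_cut I r z1 z \<delta> b) \<and>
     (\<forall>r\<in>trips I. \<forall>w. w extreme_point_of dual_poly I r \<longrightarrow> optimality_cut I r w z \<delta> b))"

definition E_obj ::
    "('n, 't) transit \<Rightarrow> 'n mat \<times> ('t \<Rightarrow> real) \<times> ('t \<Rightarrow> real) \<Rightarrow> real" where
  "E_obj I = (\<lambda>(z, \<delta>, b). design_cost I z +
     (\<Sum>r\<in>trips I - mode_trips I. real (riders I r) * b r) +
     (\<Sum>r\<in>mode_trips I. real (riders I r) * \<delta> r * (b r - net_price I)))"

definition E_optimal_within ::
    "real \<Rightarrow> ('n::finite, 't) transit \<Rightarrow> 'n mat \<times> ('t \<Rightarrow> real) \<times> ('t \<Rightarrow> real) \<Rightarrow> bool" where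
  "E_optimal_within \<epsilon> I w \<longleftrightarrow>
     E_feasible I w \<and> (\<forall>w'. E_feasible I w' \<longrightarrow> E_obj I w \<le> E_obj I w' + \<epsilon>)"

definition E_optimal ::
    "('n::finite, 't) transit \<Rightarrow> 'n mat \<times> ('t \<Rightarrow> real) \<times> ('t \<Rightarrow> real) \<Rightarrow> bool" where
  "E_optimal I w \<longleftrightarrow> E_feasible I w \<and> (\<forall>w'. E_feasible I w' \<longrightarrow> E_obj I w \<le> E_obj I w')"

definition induced_solution ::
    "('n::finite, 't) transit \<Rightarrow> 'n mat \<Rightarrow> 'n mat \<times> ('t \<Rightarrow> real) \<times> ('t \<Rightarrow> real)" where
  "induced_solution I z = (z, \<lambda>r. choice I r z, \<lambda>r. scaled_value I r z)"

type_synonym ('n, 't) rmp_point =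
  "'n mat \<times> ('t \<Rightarrow> real) \<times> ('t \<Rightarrow> real) \<times> ('t \<Rightarrow> real)"

definition rmp_feasible ::
    "('n, 't) transit \<Rightarrow> ('n, 't) cut set \<Rightarrow> ('n, 't) rmp_point set" where
  "rmp_feasible I C = {(z, \<delta>, b, \<nu>).
     z \<in> designs I \<and> weakly_connected I z \<and> (\<forall>r\<in>mode_trips I. \<delta> r \<in> {0, 1}) \<and>
     (\<forall>r\<in>mode_trips I. \<nu> r \<le> bigMr I r * \<delta> r \<and> \<nu> r \<le> b r \<and>
        \<nu> r \<ge> b r - bigMr I r * (1 - \<delta> r) \<and> \<nu> r \<ge> 0) \<and>
     (\<forall>c\<in>C. c z \<delta> b)}"

definition rmp_obj :: "('n, 't) transit \<Rightarrow> ('n, 't) rmp_point \<Rightarrow> real" where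
  "rmp_obj I = (\<lambda>(z, \<delta>, b, \<nu>). design_cost I z +
     (\<Sum>r\<in>trips I - mode_trips I. real (riders I r) * b r) +
     (\<Sum>r\<in>mode_trips I. real (riders I r) * (\<nu> r - \<delta> r * net_price I)))"

definition rmp_value :: "('n, 't) transit \<Rightarrow> ('n, 't) cut set \<Rightarrow> ereal" where
  "rmp_value I C = (INF w\<in>rmp_feasible I C. ereal (rmp_obj I w))"

text \<open>Before any optimality cut is present the relaxed master problem may be unbounded below.
  In that case its value is \<open>-\<infinity>\<close> and any feasible point may be returned.\<close>

definition rmp_solution ::
    "('n, 't) transit \<Rightarrow> ('n, 't) cut set \<Rightarrow> ('n, 't) rmp_point \<Rightarrow> bool" where
  "rmp_solution I C w \<longleftrightarrow> w \<in> rmp_feasible I C \<and>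
     (ereal (rmp_obj I w) = rmp_value I C \<or> rmp_value I C = - \<infinity>)"

definition direct_route :: "('n, 't) transit \<Rightarrow> 't \<Rightarrow> 'n route \<Rightarrow> bool" where
  "direct_route I r w \<longleftrightarrow> snd w (orig I r) (dest I r) = 1"

definition hub_route :: "('n, 't) transit \<Rightarrow> 't \<Rightarrow> 'n route \<Rightarrow> 'n \<Rightarrow> 'n \<Rightarrow> bool" where
  "hub_route I r w m n \<longleftrightarrow>
     m \<in> hubs I \<and> n \<in> hubs I \<and> snd w (orig I r) m = 1 \<and> snd w n (dest I r) = 1"

definition hub_dists :: "('n, 't) transit \<Rightarrow> 't \<Rightarrow> real set" where
  "hub_dists I r = (\<lambda>(h, l). tdist I (orig I r) h + tdist I l (dest I r)) ` (hubs I \<times> hubs I)"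

definition Dminus :: "('n, 't) transit \<Rightarrow> 't \<Rightarrow> real" where
  "Dminus I r = Min (hub_dists I r)"

definition Dplus :: "('n, 't) transit \<Rightarrow> 't \<Rightarrow> real" where
  "Dplus I r = max (Max (hub_dists I r)) (tdist I (orig I r) (dest I r))"

definition time_per_dist :: "('n, 't) transit \<Rightarrow> real" where
  "time_per_dist I = (1 - weight I) / weight I * shuttle_cost I"

text \<open>The two time bounds divide by the weight, so the inequalities relying on them are only
  generated when the weight is positive.\<close>

definition time_ub_le_threshold :: "('n, 't) transit \<Rightarrow> 't \<Rightarrow> 'n route \<Rightarrow> bool" where
  "time_ub_le_threshold I r w \<longleftrightarrow> 0 < weight I \<and>
     (let t1 = route_time I r w; a = patience I r * cur_time I r in
       (direct_route I r w \<and>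
          max t1 (t1 + time_per_dist I * (tdist I (orig I r) (dest I r) - Dminus I r)) \<le> a) \<or>
       (\<exists>m n. hub_route I r w m n \<and>
          t1 + time_per_dist I * (tdist I (orig I r) m + tdist I n (dest I r) - Dminus I r) \<le> a))"

definition time_lb_ge_threshold :: "('n, 't) transit \<Rightarrow> 't \<Rightarrow> 'n route \<Rightarrow> bool" where
  "time_lb_ge_threshold I r w \<longleftrightarrow> 0 < weight I \<and>
     (let t1 = route_time I r w; a = patience I r * cur_time I r in
       (direct_route I r w \<and> t1 \<ge> a) \<or>
       (\<exists>m n. hub_route I r w m n \<and>
          t1 + time_per_dist I * (tdist I (orig I r) m + tdist I n (dest I r) - Dplus I r) \<ge> a))"

definition active_hubs :: "('n, 't) transit \<Rightarrow> 'n mat \<Rightarrow> 'n set" where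
  "active_hubs I z1 = {h \<in> hubs I. (\<Sum>l\<in>hubs I. z1 h l) > 0}"

definition closer_from_orig :: "('n, 't) transit \<Rightarrow> 't \<Rightarrow> 'n mat \<Rightarrow> 'n set" where
  "closer_from_orig I r z1 = {h \<in> hubs I - active_hubs I z1.
     tdist I (orig I r) h < Min ((\<lambda>h'. tdist I (orig I r) h') ` active_hubs I z1)}"

definition closer_to_dest :: "('n, 't) transit \<Rightarrow> 't \<Rightarrow> 'n mat \<Rightarrow> 'n set" where
  "closer_to_dest I r z1 = {h \<in> hubs I - active_hubs I z1.
     tdist I h (dest I r) < Min ((\<lambda>h'. tdist I h' (dest I r)) ` active_hubs I z1)}"

definition closest_hub_route :: "('n, 't) transit \<Rightarrow> 't \<Rightarrow> 'n mat \<Rightarrow> 'n route \<Rightarrow> bool" where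
  "closest_hub_route I r z1 w \<longleftrightarrow> (\<exists>m n. hub_route I r w m n \<and>
     m \<in> active_hubs I z1 \<and> n \<in> active_hubs I z1 \<and>
     (\<forall>h\<in>active_hubs I z1. tdist I (orig I r) m \<le> tdist I (orig I r) h) \<and>
     (\<forall>h\<in>active_hubs I z1. tdist I n (dest I r) \<le> tdist I h (dest I r)))"

definition num_used_closed :: "('n, 't) transit \<Rightarrow> 'n route \<Rightarrow> 'n mat \<Rightarrow> real" where
  "num_used_closed I w z =
     (\<Sum>(h, l)\<in>{(h, l) \<in> hubs I \<times> hubs I. fst w h l = 1}. 1 - z h l)"

text \<open>The strengthening inequalities generated for a design \<open>z1\<close>, at which \<open>w\<close>
  is the optimal route of the rider.\<close>

definition strengthening_cuts ::
    "('n::finite, 't) transit \<Rightarrow> 't \<Rightarrow> 'n mat \<Rightarrow> 'n route \<Rightarrow> ('n, 't) cut set" where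
  "strengthening_cuts I r z1 w = {c. orig I r \<notin> hubs I \<and> dest I r \<notin> hubs I \<and>
     (choice I r z1 = 1 \<and> time_ub_le_threshold I r w \<and>
        c = (\<lambda>z \<delta> b. num_closed I z1 z + \<delta> r \<ge> 1) \<or>
      choice I r z1 = 0 \<and> time_lb_ge_threshold I r w \<and>
        c = (\<lambda>z \<delta> b. num_opened I z1 z \<ge> \<delta> r) \<or>
      choice I r z1 = 1 \<and> closest_hub_route I r z1 w \<and>
        c = (\<lambda>z \<delta> b. (\<Sum>h\<in>closer_from_orig I r z1 \<union> closer_to_dest I r z1. \<Sum>l\<in>hubs I. z h l) +
                num_closed I z1 z + \<delta> r \<ge> 1) \<or>
      choice I r z1 = 1 \<and>
        c = (\<lambda>z \<delta> b. num_used_closed I w z + num_opened I z1 z + \<delta> r \<ge> 1) \<or>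
      choice I r z1 = 0 \<and>
        c = (\<lambda>z \<delta> b. num_used_closed I w z + num_opened I z1 z \<ge> \<delta> r))}"

record ('n, 't) state =
  lower :: ereal
  upper :: ereal
  incumbent :: "'n mat option"
  cuts :: "('n, 't) cut set"

definition init_state :: "('n, 't) state" where
  "init_state = \<lparr>lower = - \<infinity>, upper = \<infinity>, incumbent = None, cuts = {}\<rparr>"

definition running :: "real \<Rightarrow> ('n, 't) state \<Rightarrow> bool" where
  "running \<epsilon> s \<longleftrightarrow> upper s > lower s + ereal \<epsilon>"

definition candidate_value :: "('n::finite, 't) transit \<Rightarrow> 'n mat \<Rightarrow> real" where
  "candidate_value I z = design_cost I z +
     (\<Sum>r\<in>trips I - mode_trips I. real (riders I r) * scaled_value I r z) +
     (\<Sum>r\<in>mode_trips I. real (riders I r) * choice I r z * (scaled_value I r z - net_price I))"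

text \<open>One iteration. It is a relation because the solutions of the relaxed master problem, the
  optimal dual vertices \<open>W\<close> and the optimal routes \<open>R\<close> need not be unique.\<close>

definition iteration ::
    "('n::finite, 't) transit \<Rightarrow> real \<Rightarrow> ('n, 't) state \<Rightarrow> ('n, 't) state \<Rightarrow> bool" where
  "iteration I \<epsilon> s s' \<longleftrightarrow> running \<epsilon> s \<and>
     (\<exists>z \<delta> b \<nu> W R.
        rmp_solution I (cuts s) (z, \<delta>, b, \<nu>) \<and>
        (\<forall>r\<in>trips I. optimal_dual_vertex I r z (W r)) \<and>
        (\<forall>r\<in>mode_trips I. optimal_route I r z (R r)) \<and>
        lower s' = rmp_value I (cuts s) \<and>
        cuts s' = cuts s
          \<union> {optimality_cut I r (W r) | r. r \<in> trips I}
          \<union> {choice_cut I r z | r. r \<in> mode_trips I \<and> \<delta> r \<noteq> choice I r z}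
          \<union> (\<Union>r\<in>mode_trips I. strengthening_cuts I r z (R r)) \<and>
        (if ereal (candidate_value I z) < upper s
         then upper s' = ereal (candidate_value I z) \<and> incumbent s' = Some z
         else upper s' = upper s \<and> incumbent s' = incumbent s))"

definition reachable ::
    "('n::finite, 't) transit \<Rightarrow> real \<Rightarrow> ('n, 't) state \<Rightarrow> bool" where
  "reachable I \<epsilon> s \<longleftrightarrow> (iteration I \<epsilon>)\<^sup>*\<^sup>* init_state s"

text \<open>The algorithm never gets stuck, and no execution performs infinitely many iterations.\<close>

definition terminates :: "('n::finite, 't) transit \<Rightarrow> real \<Rightarrow> bool" where
  "terminates I \<epsilon> \<longleftrightarrow>
     (\<forall>s. reachable I \<epsilon> s \<and> running \<epsilon> s \<longrightarrow> (\<exists>s'. iteration I \<epsilon> s s')) \<and>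
     \<not> (\<exists>S. S 0 = init_state \<and> (\<forall>k. iteration I \<epsilon> (S k) (S (Suc k))))"

definition returns ::
    "('n::finite, 't) transit \<Rightarrow> real \<Rightarrow> ('n mat option \<Rightarrow> bool) \<Rightarrow> bool" where
  "returns I \<epsilon> P \<longleftrightarrow>
     (\<forall>s. reachable I \<epsilon> s \<and> \<not> running \<epsilon> s \<longrightarrow> P (incumbent s))"

end

theory Submission
  imports Defs
begin

text \<open>The arc costs are nonnegative, so distances to the destination are attained by simple
  paths, and these distances are potentials that solve the dual of the follower problem integrally.
  Hence the optimality cuts at an optimal dual vertex of a design price that design exactly, and no
  vertex ever overestimates a design.

  The choice cuts and (V1)--(V5) never exclude the solution induced by a weakly connected design, so
  the value of the relaxed master problem stays a lower bound. Once a design has been visited with a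
  given adoption vector, its cuts either exclude this pair or force its cost up to the candidate
  value. As there are finitely many pairs, some pair recurs and the bounds meet. Finitely many
  candidate values also leave a gap above the optimum, so a small tolerance yields exact
  optimality.\<close>

section \<open>Strong duality for the follower problem\<close>

text \<open>Duality is obtained combinatorially: a shortest simple path and the shortest-distance
  potentials form a primal-dual pair of equal value. In particular the scaled objective M b + f is
  minimised by a binary route, and \<open>scaling_valid\<close> turns such a minimiser into a
  lexicographic optimum. Values of \<open>b\<close> are in these scaled units throughout, also in
  \<open>candidate_value\<close>.

  Two attainment questions shape the rest. The set of optimal dual points is unbounded, since
  raising all components of u by the same amount preserves feasibility and objective, so a vertex
  has to be extracted from an unbounded face. The relaxed master problem has real variables b and
  \<nu>, and it is unbounded below as long as some trip without mode choice has riders but no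
  optimality cut. For later cut sets attainment is proved by replacing b with a supremum of cut
  values, which works for an arbitrary set of cuts.\<close>

lemma sum_arcs_UNIV:
  fixes f y :: "'n::finite \<Rightarrow> 'n \<Rightarrow> real"
  assumes "\<And>i j. (i, j) \<notin> A \<Longrightarrow> y i j = 0"
  shows "(\<Sum>(i, j)\<in>A. f i j * y i j) = (\<Sum>i\<in>UNIV. \<Sum>j\<in>UNIV. f i j * y i j)"
proof -
  have "(\<Sum>(i, j)\<in>A. f i j * y i j) = (\<Sum>(i, j)\<in>UNIV. f i j * y i j)"
    by (rule sum.mono_neutral_left) (use assms in auto)
  then show ?thesis
    by (simp add: sum.cartesian_product)
qed

lemma sum_hubs_UNIV:
  fixes f x :: "'n::finite \<Rightarrow> 'n \<Rightarrow> real"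
  assumes "\<And>i j. i \<notin> H \<or> j \<notin> H \<Longrightarrow> x i j = 0"
  shows "(\<Sum>h\<in>H. \<Sum>l\<in>H. f h l * x h l) = (\<Sum>i\<in>UNIV. \<Sum>j\<in>UNIV. f i j * x i j)"
proof -
  have "(\<Sum>h\<in>H. \<Sum>l\<in>H. f h l * x h l) = (\<Sum>(h, l)\<in>H \<times> H. f h l * x h l)"
    by (rule sum.cartesian_product)
  also have "\<dots> = (\<Sum>i\<in>UNIV. \<Sum>j\<in>UNIV. f i j * x i j)"
    by (rule sum_arcs_UNIV) (use assms in auto)
  finally show ?thesis .
qed

definition scaled_cost :: "('n, 't) transit \<Rightarrow> 't \<Rightarrow> 'n route \<Rightarrow> real" where
  "scaled_cost I r w = bigM I * route_cost I r w + route_time I r w"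

lemma routes_bus:
  assumes "(x, y) \<in> routes I r z"
  shows "h \<in> hubs I \<Longrightarrow> l \<in> hubs I \<Longrightarrow> x h l \<in> {0, 1}"
    and "h \<in> hubs I \<Longrightarrow> l \<in> hubs I \<Longrightarrow> x h l \<le> z h l"
    and "h \<notin> hubs I \<or> l \<notin> hubs I \<Longrightarrow> x h l = 0"
    and "x h l \<in> {0, 1}"
proof -
  have *: "if h \<in> hubs I \<and> l \<in> hubs I then x h l \<in> {0, 1} \<and> x h l \<le> z h l else x h l = 0" for h l
    using assms unfolding routes_def by blast
  show "h \<in> hubs I \<Longrightarrow> l \<in> hubs I \<Longrightarrow> x h l \<in> {0, 1}"
    "h \<in> hubs I \<Longrightarrow> l \<in> hubs I \<Longrightarrow> x h l \<le> z h l"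
    "h \<notin> hubs I \<or> l \<notin> hubs I \<Longrightarrow> x h l = 0"
    "x h l \<in> {0, 1}"
    using *[of h l] by (auto split: if_splits)
qed

lemma routes_shuttle:
  assumes "(x, y) \<in> routes I r z"
  shows "(i, j) \<notin> shuttle_arcs I r \<Longrightarrow> y i j = 0"
    and "y i j \<in> {0, 1}"
proof -
  have *: "if (i, j) \<in> shuttle_arcs I r then y i j \<in> {0, 1} else y i j = 0" for i j
    using assms unfolding routes_def by blast
  show "(i, j) \<notin> shuttle_arcs I r \<Longrightarrow> y i j = 0" "y i j \<in> {0, 1}"
    using *[of i j] by (auto split: if_splits)
qed

lemma routes_flow:
  assumes "(x, y) \<in> routes I r z"
  shows "(\<Sum>j\<in>UNIV. x i j + y i j) - (\<Sum>j\<in>UNIV. x j i + y j i) =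
    (if i = orig I r then 1 else if i = dest I r then - 1 else 0)"
  using assms unfolding routes_def by blast

lemma routes_nonneg:
  assumes "(x, y) \<in> routes I r z"
  shows "0 \<le> x i j" "0 \<le> y i j"
  using routes_bus(4)[OF assms, of i j] routes_shuttle(2)[OF assms, of i j] by auto

text \<open>Opening legs only enlarges the set of routes. All comparisons between designs in the
  validity proofs go through such inclusions.\<close>

lemma routes_mono:
  assumes "\<And>h l. h \<in> hubs I \<Longrightarrow> l \<in> hubs I \<Longrightarrow> z1 h l \<le> z h l"
  shows "routes I r z1 \<subseteq> routes I r z"
proof
  fix w
  assume "w \<in> routes I r z1"
  then obtain x y where w: "w = (x, y)" and xy: "(x, y) \<in> routes I r z1" by (cases w) auto
  have "if h \<in> hubs I \<and> l \<in> hubs I then x h l \<in> {0, 1} \<and> x h l \<le> z h l else x h l = 0" for h l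
    using routes_bus[OF xy] assms by (metis order_trans)
  moreover have "if (i, j) \<in> shuttle_arcs I r then y i j \<in> {0, 1} else y i j = 0" for i j
    using routes_shuttle[OF xy] by metis
  ultimately show "w \<in> routes I r z"
    using routes_flow[OF xy] unfolding w routes_def by blast
qed

lemma design_entry:
  assumes "z \<in> designs I"
  shows "z h l = 0 \<or> z h l = 1"
proof -
  have "if h \<in> hubs I \<and> l \<in> hubs I then z h l \<in> {0, 1} else z h l = 0"
    using assms unfolding designs_def by blast
  then show ?thesis by (auto split: if_splits)
qed

lemma design_nonneg: "z \<in> designs I \<Longrightarrow> 0 \<le> z h l"
  using design_entry[of z I h l] by auto

text \<open>Sums over all pairs of nodes allow the flow equations, which range over
  \<open>UNIV\<close>, to be combined with the cost by exchanging summations.\<close>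

lemma scaled_cost_eq:
  fixes I :: "('n::finite, 't) transit"
  assumes x: "\<And>i j. i \<notin> hubs I \<or> j \<notin> hubs I \<Longrightarrow> x i j = 0"
    and y: "\<And>i j. (i, j) \<notin> shuttle_arcs I r \<Longrightarrow> y i j = 0"
  shows "scaled_cost I r (x, y) =
    (\<Sum>i\<in>UNIV. \<Sum>j\<in>UNIV. tau_hat I i j * x i j + gamma_hat I i j * y i j)"
proof -
  have bus: "(\<Sum>h\<in>hubs I. \<Sum>l\<in>hubs I. f h l * x h l) = (\<Sum>i\<in>UNIV. \<Sum>j\<in>UNIV. f i j * x i j)" for f
    by (rule sum_hubs_UNIV) (rule x)
  have shuttle: "(\<Sum>(i, j)\<in>shuttle_arcs I r. f i j * y i j) = (\<Sum>i\<in>UNIV. \<Sum>j\<in>UNIV. f i j * y i j)" for f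
    by (rule sum_arcs_UNIV) (rule y)
  show ?thesis
    unfolding scaled_cost_def route_cost_def route_time_def prod.case bus shuttle
    by (simp add: tau_hat_def gamma_hat_def sum.distrib sum_distrib_left algebra_simps)
qed

text \<open>Weight the flow equation of each node i by u_i, add up, and regroup by arcs. Every arc
  then contributes at most its cost, plus z v on bus legs because x \<le> z and v \<ge> 0.\<close>

lemma weak_duality:
  fixes I :: "('n::finite, 't) transit"
  assumes od: "orig I r \<noteq> dest I r"
    and uv: "(u, v) \<in> dual_poly I r" and w: "(x, y) \<in> routes I r z"
  shows "dual_obj I r z (u, v) \<le> scaled_cost I r (x, y)"
proof -
  let ?o = "orig I r" and ?d = "dest I r" and ?H = "hubs I"
  have "u $ ?o - u $ ?d = (\<Sum>i\<in>UNIV. u $ i * (if i = ?o then 1 else if i = ?d then - 1 else 0))"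
  proof -
    have "(\<Sum>i\<in>UNIV. u $ i * (if i = ?o then 1 else if i = ?d then - 1 else 0)) =
      (\<Sum>i\<in>UNIV. (if i = ?o then u $ i else 0) - (if i = ?d then u $ i else 0))"
      using od by (intro sum.cong) auto
    also have "\<dots> = u $ ?o - u $ ?d"
      by (simp add: sum_subtractf)
    finally show ?thesis by simp
  qed
  also have "\<dots> = (\<Sum>i\<in>UNIV. u $ i * ((\<Sum>j\<in>UNIV. x i j + y i j) - (\<Sum>j\<in>UNIV. x j i + y j i)))"
    by (simp add: routes_flow[OF w])
  also have "\<dots> = (\<Sum>i\<in>UNIV. \<Sum>j\<in>UNIV. u $ i * (x i j + y i j)) -
      (\<Sum>i\<in>UNIV. \<Sum>j\<in>UNIV. u $ i * (x j i + y j i))"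
    by (simp add: right_diff_distrib sum_subtractf sum_distrib_left)
  \<comment> \<open>Renaming the summation indices of the inflow lets both sums run over the same
    arc (i, j), where the weights combine to u_i - u_j.\<close>
  also have "(\<Sum>i\<in>UNIV. \<Sum>j\<in>UNIV. u $ i * (x j i + y j i)) =
      (\<Sum>i\<in>UNIV. \<Sum>j\<in>UNIV. u $ j * (x i j + y i j))"
    by (rule sum.swap)
  also have "(\<Sum>i\<in>UNIV. \<Sum>j\<in>UNIV. u $ i * (x i j + y i j)) - \<dots> =
      (\<Sum>i\<in>UNIV. \<Sum>j\<in>UNIV. (u $ i - u $ j) * (x i j + y i j))"
    by (simp add: left_diff_distrib sum_subtractf)
  also have "\<dots> \<le> (\<Sum>i\<in>UNIV. \<Sum>j\<in>UNIV.
      tau_hat I i j * x i j + gamma_hat I i j * y i j + z i j * v $ i $ j)"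
  proof (intro sum_mono)
    fix i j
    have "(u $ i - u $ j) * x i j \<le> tau_hat I i j * x i j + z i j * v $ i $ j"
    proof (cases "i \<in> ?H \<and> j \<in> ?H")
      case True
      then have "u $ i - u $ j - v $ i $ j \<le> tau_hat I i j" and "0 \<le> v $ i $ j"
        using uv unfolding dual_poly_def by auto
      moreover have "x i j = 0 \<or> x i j = 1" "x i j \<le> z i j"
        using routes_bus(1,2)[OF w] True by auto
      moreover have "x i j * v $ i $ j \<le> z i j * v $ i $ j"
        using \<open>x i j \<le> z i j\<close> \<open>0 \<le> v $ i $ j\<close> by (rule mult_right_mono)
      ultimately show ?thesis by auto
    next
      case False
      then have "x i j = 0" "v $ i $ j = 0"
        using routes_bus(3)[OF w] uv unfolding dual_poly_def by auto
      then show ?thesis by simp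
    qed
    moreover have "(u $ i - u $ j) * y i j \<le> gamma_hat I i j * y i j"
    proof (cases "(i, j) \<in> shuttle_arcs I r")
      case True
      then have "u $ i - u $ j \<le> gamma_hat I i j"
        using uv unfolding dual_poly_def by auto
      then show ?thesis
        using routes_nonneg(2)[OF w] by (rule mult_right_mono)
    next
      case False
      then show ?thesis using routes_shuttle(1)[OF w] by simp
    qed
    ultimately show "(u $ i - u $ j) * (x i j + y i j) \<le>
        tau_hat I i j * x i j + gamma_hat I i j * y i j + z i j * v $ i $ j"
      by (simp add: distrib_left)
  qed
  also have "\<dots> = scaled_cost I r (x, y) + (\<Sum>i\<in>UNIV. \<Sum>j\<in>UNIV. z i j * v $ i $ j)"
    using scaled_cost_eq[of I x r y] routes_bus(3)[OF w] routes_shuttle(1)[OF w]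
    by (simp add: sum.distrib)
  also have "(\<Sum>i\<in>UNIV. \<Sum>j\<in>UNIV. z i j * v $ i $ j) = (\<Sum>h\<in>?H. \<Sum>l\<in>?H. z h l * v $ h $ l)"
    by (rule sum_hubs_UNIV[symmetric]) (use uv in \<open>auto simp: dual_poly_def\<close>)
  finally show ?thesis
    unfolding dual_obj_def by simp
qed

section \<open>Simple paths and the unit flow they carry\<close>

text \<open>A set is enough since a path with distinct nodes repeats no arc, so sums over the set
  count every arc once.\<close>

definition path_arcs :: "'n list \<Rightarrow> ('n \<times> 'n) set" where
  "path_arcs p = set (zip p (tl p))"

lemma path_arcs_simps [simp]:
  "path_arcs [] = {}" "path_arcs [a] = {}"
  "path_arcs (a # b # p) = insert (a, b) (path_arcs (b # p))"
  by (simp_all add: path_arcs_def)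

lemma path_arcs_subset: "path_arcs p \<subseteq> set p \<times> set p"
  by (induction p rule: induct_list012) auto

lemma path_arcs_append: "path_arcs q \<subseteq> path_arcs (p @ q)"
proof (induction p)
  case (Cons a p)
  then show ?case
    by (cases "p @ q") auto
qed simp

lemma finite_path_arcs [simp]: "finite (path_arcs p)"
  by (simp add: path_arcs_def)

lemma path_arcs_successively: "successively P p \<Longrightarrow> (i, j) \<in> path_arcs p \<Longrightarrow> P i j"
  by (induction p rule: induct_list012) auto

text \<open>Telescoping by induction: a new head contributes one arc, which is absent from the rest
  because its tail is a new node. Its contribution moves the source from the old head to the new
  one.\<close>

lemma path_net_flow:
  fixes p :: "'n::finite list"
  assumes "distinct p" "p \<noteq> []"
  shows "(\<Sum>j\<in>UNIV. of_bool ((i, j) \<in> path_arcs p)) - (\<Sum>j\<in>UNIV. of_bool ((j, i) \<in> path_arcs p)) =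
    (of_bool (i = hd p) - of_bool (i = last p) :: real)"
  using assms
proof (induction p rule: induct_list012)
  case (3 a b p)
  have "(a, b) \<notin> path_arcs (b # p)"
    using 3(3) path_arcs_subset[of "b # p"] by auto
  then have ins: "of_bool ((k, j) \<in> path_arcs (a # b # p)) =
      (of_bool (k = a \<and> j = b) + of_bool ((k, j) \<in> path_arcs (b # p)) :: real)" for k j
    by auto
  have "(\<Sum>j\<in>UNIV. of_bool (i = a \<and> j = b)) = (of_bool (i = a) :: real)"
    "(\<Sum>j\<in>UNIV. of_bool (j = a \<and> i = b)) = (of_bool (i = b) :: real)"
    by (cases "i = a"; cases "i = b"; simp add: of_bool_def)+
  then show ?case
    using 3(2,3) by (simp add: ins sum.distrib del: path_arcs_simps)
qed auto

section \<open>Shortest-path potentials\<close>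

text \<open>If the origin or the destination is itself a hub, an arc can be both an open bus leg and
  a shuttle arc. The cheaper mode is then fixed here, with ties going to the bus, so that every arc
  has a single cost.\<close>

definition use_bus :: "('n, 't) transit \<Rightarrow> 't \<Rightarrow> 'n mat \<Rightarrow> 'n \<Rightarrow> 'n \<Rightarrow> bool" where
  "use_bus I r z i j \<longleftrightarrow> i \<in> hubs I \<and> j \<in> hubs I \<and> z i j = 1 \<and>
     ((i, j) \<in> shuttle_arcs I r \<longrightarrow> tau_hat I i j \<le> gamma_hat I i j)"

definition arc_cost :: "('n, 't) transit \<Rightarrow> 't \<Rightarrow> 'n mat \<Rightarrow> 'n \<Rightarrow> 'n \<Rightarrow> real" where
  "arc_cost I r z i j = (if use_bus I r z i j then tau_hat I i j else gamma_hat I i j)"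

definition usable :: "('n, 't) transit \<Rightarrow> 't \<Rightarrow> 'n mat \<Rightarrow> 'n \<Rightarrow> 'n \<Rightarrow> bool" where
  "usable I r z i j \<longleftrightarrow> use_bus I r z i j \<or> (i, j) \<in> shuttle_arcs I r"

text \<open>Restricting to simple paths makes this set finite, so that the minimum in
  \<open>potential\<close> exists.\<close>

definition paths_to_dest :: "('n, 't) transit \<Rightarrow> 't \<Rightarrow> 'n mat \<Rightarrow> 'n \<Rightarrow> 'n list set" where
  "paths_to_dest I r z i =
     {p. p \<noteq> [] \<and> hd p = i \<and> last p = dest I r \<and> distinct p \<and> successively (usable I r z) p}"

definition path_cost :: "('n, 't) transit \<Rightarrow> 't \<Rightarrow> 'n mat \<Rightarrow> 'n list \<Rightarrow> real" where
  "path_cost I r z p = (\<Sum>(i, j)\<in>path_arcs p. arc_cost I r z i j)"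

text \<open>The shortest distance to the destination. The default 0 concerns only nodes other than
  the hubs, the origin and the destination, where the sign constraint is the only dual constraint on
  u.\<close>

definition potential :: "('n::finite, 't) transit \<Rightarrow> 't \<Rightarrow> 'n mat \<Rightarrow> 'n \<Rightarrow> real" where
  "potential I r z i = (if paths_to_dest I r z i = {} then 0
     else Min (path_cost I r z ` paths_to_dest I r z i))"

definition path_route :: "('n, 't) transit \<Rightarrow> 't \<Rightarrow> 'n mat \<Rightarrow> 'n list \<Rightarrow> 'n route" where
  "path_route I r z p =
     ((\<lambda>i j. of_bool ((i, j) \<in> path_arcs p \<and> use_bus I r z i j)),
      (\<lambda>i j. of_bool ((i, j) \<in> path_arcs p \<and> \<not> use_bus I r z i j)))"

lemma path_route_in_routes:
  fixes I :: "('n::finite, 't) transit"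
  assumes "orig I r \<noteq> dest I r" and z: "z \<in> designs I"
    and p: "p \<in> paths_to_dest I r z (orig I r)"
  shows "path_route I r z p \<in> routes I r z"
proof -
  \<comment> \<open>Arcs of the path are usable, so one that is not travelled by bus must be a
    shuttle arc.\<close>
  have sh: "(i, j) \<in> shuttle_arcs I r" if "(i, j) \<in> path_arcs p" "\<not> use_bus I r z i j" for i j
    using p path_arcs_successively[of "usable I r z" p i j] that
    unfolding paths_to_dest_def usable_def by auto
  obtain x y where xy: "path_route I r z p = (x, y)" by (cases "path_route I r z p")
  then have x: "x = (\<lambda>i j. of_bool ((i, j) \<in> path_arcs p \<and> use_bus I r z i j))"
    and y: "y = (\<lambda>i j. of_bool ((i, j) \<in> path_arcs p \<and> \<not> use_bus I r z i j))"
    unfolding path_route_def by auto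
  have path: "p \<noteq> []" "hd p = orig I r" "last p = dest I r" "distinct p"
    using p unfolding paths_to_dest_def by auto
  have sum1: "x i j + y i j = of_bool ((i, j) \<in> path_arcs p)" for i j
    by (simp add: x y)
  have "(\<Sum>j\<in>UNIV. x i j + y i j) - (\<Sum>j\<in>UNIV. x j i + y j i) =
      (if i = orig I r then 1 else if i = dest I r then - 1 else 0)" for i
    unfolding sum1 path_net_flow[OF path(4,1)] using path(2,3) assms(1) by auto
  moreover have "if h \<in> hubs I \<and> l \<in> hubs I then x h l \<in> {0, 1} \<and> x h l \<le> z h l else x h l = 0" for h l
    using design_nonneg[OF z, of h l] by (auto simp: x use_bus_def)
  moreover have "if (i, j) \<in> shuttle_arcs I r then y i j \<in> {0, 1} else y i j = 0" for i j
    using sh[of i j] by (auto simp: y)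
  ultimately show ?thesis
    unfolding xy routes_def by blast
qed

lemma scaled_cost_path_route:
  fixes I :: "('n::finite, 't) transit"
  assumes p: "p \<in> paths_to_dest I r z i"
  shows "scaled_cost I r (path_route I r z p) = path_cost I r z p"
proof -
  have sh: "(i, j) \<in> shuttle_arcs I r" if "(i, j) \<in> path_arcs p" "\<not> use_bus I r z i j" for i j
    using p path_arcs_successively[of "usable I r z" p i j] that
    unfolding paths_to_dest_def usable_def by auto
  have "scaled_cost I r (path_route I r z p) =
    (\<Sum>i\<in>UNIV. \<Sum>j\<in>UNIV. tau_hat I i j * of_bool ((i, j) \<in> path_arcs p \<and> use_bus I r z i j) +
      gamma_hat I i j * of_bool ((i, j) \<in> path_arcs p \<and> \<not> use_bus I r z i j))"
    unfolding path_route_def by (rule scaled_cost_eq) (auto simp: use_bus_def dest: sh)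
  also have "\<dots> = (\<Sum>i\<in>UNIV. \<Sum>j\<in>UNIV. arc_cost I r z i j * of_bool ((i, j) \<in> path_arcs p))"
    by (intro sum.cong refl) (simp add: arc_cost_def)
  also have "\<dots> = (\<Sum>(i, j)\<in>path_arcs p. arc_cost I r z i j * of_bool ((i, j) \<in> path_arcs p))"
    by (rule sum_arcs_UNIV[symmetric]) simp
  also have "\<dots> = path_cost I r z p"
    unfolding path_cost_def by (intro sum.cong) auto
  finally show ?thesis .
qed

lemma finite_paths_to_dest [simp]:
  "finite (paths_to_dest I r z i)" for I :: "('n::finite, 't) transit"
  by (rule finite_subset[OF _ finite_subset_distinct[of "UNIV :: 'n set"]])
    (auto simp: paths_to_dest_def)

lemma potential_attained:
  fixes I :: "('n::finite, 't) transit"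
  assumes "paths_to_dest I r z i \<noteq> {}"
  obtains p where "p \<in> paths_to_dest I r z i" "potential I r z i = path_cost I r z p"
proof -
  have "Min (path_cost I r z ` paths_to_dest I r z i) \<in> path_cost I r z ` paths_to_dest I r z i"
    using assms by (intro Min_in) auto
  then obtain p where "p \<in> paths_to_dest I r z i"
      "Min (path_cost I r z ` paths_to_dest I r z i) = path_cost I r z p"
    by (rule imageE) auto
  then show thesis using that[of p] assms unfolding potential_def by simp
qed

lemma potential_le:
  fixes I :: "('n::finite, 't) transit"
  assumes "p \<in> paths_to_dest I r z i"
  shows "potential I r z i \<le> path_cost I r z p"
  using assms unfolding potential_def by (auto intro: Min_le)

section \<open>Nonnegative costs and strong duality\<close>

locale transit_network =
  fixes I :: "('n::finite, 't) transit"
  assumes valid: "valid_data I"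
    and scaling: "scaling_valid I"
    and bound: "bound_valid I"
begin

lemma time_nonneg: "0 \<le> ttime I i j"
  and dist_nonneg: "0 \<le> tdist I i j"
  and time_triangle: "ttime I i k \<le> ttime I i j + ttime I j k"
  and dist_triangle: "tdist I i k \<le> tdist I i j + tdist I j k"
  and weight_nonneg: "0 \<le> weight I"
  and weight_le_1: "weight I \<le> 1"
  and shuttle_cost_nonneg: "0 \<le> shuttle_cost I"
  and wait_nonneg: "0 \<le> bus_wait I"
  and finite_trips: "finite (trips I)"
  and mode_trips_subset: "mode_trips I \<subseteq> trips I"
  and orig_neq_dest: "r \<in> trips I \<Longrightarrow> orig I r \<noteq> dest I r"
  using valid unfolding valid_data_def by auto

lemma bigM_pos: "0 < bigM I"
  using scaling unfolding scaling_valid_def by auto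

lemma tau_nonneg: "0 \<le> tau I i j"
  using time_nonneg wait_nonneg weight_nonneg unfolding tau_def by simp

lemma gamma_nonneg: "0 \<le> gamma I i j"
  using time_nonneg dist_nonneg weight_nonneg weight_le_1 shuttle_cost_nonneg
  unfolding gamma_def by simp

lemma tau_hat_nonneg: "0 \<le> tau_hat I i j"
  using tau_nonneg time_nonneg wait_nonneg bigM_pos unfolding tau_hat_def by (simp add: add.assoc)

lemma gamma_hat_nonneg: "0 \<le> gamma_hat I i j"
  using gamma_nonneg time_nonneg bigM_pos unfolding gamma_hat_def by simp

lemma arc_cost_nonneg: "0 \<le> arc_cost I r z i j"
  using tau_hat_nonneg gamma_hat_nonneg unfolding arc_cost_def by auto

lemma path_cost_nonneg: "0 \<le> path_cost I r z p"
  unfolding path_cost_def by (auto intro!: sum_nonneg simp: arc_cost_nonneg)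

lemma potential_nonneg: "0 \<le> potential I r z i"
proof (cases "paths_to_dest I r z i = {}")
  case True
  then show ?thesis by (simp add: potential_def)
next
  case False
  then show ?thesis using path_cost_nonneg by (metis potential_attained)
qed

text \<open>The triangle inequality of shortest distances: prepend i to a shortest path from j,
  unless i already lies on that path.\<close>

lemma potential_arc:
  assumes u: "usable I r z i j" and ne: "paths_to_dest I r z j \<noteq> {}"
  shows "potential I r z i \<le> arc_cost I r z i j + potential I r z j"
proof -
  obtain p where p: "p \<in> paths_to_dest I r z j" and cost: "potential I r z j = path_cost I r z p"
    using potential_attained[OF ne] .
  obtain q where q: "p = j # q"
    using p unfolding paths_to_dest_def by (cases p) auto
  show ?thesis
  proof (cases "i \<in> set p")
    case False
    then have "i # p \<in> paths_to_dest I r z i"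
      using p u unfolding paths_to_dest_def q by auto
    moreover have "path_cost I r z (i # p) = arc_cost I r z i j + path_cost I r z p"
    proof -
      have "(i, j) \<notin> path_arcs p" using False path_arcs_subset[of p] by auto
      then show ?thesis unfolding path_cost_def q by simp
    qed
    ultimately show ?thesis using potential_le cost by metis
  next
    \<comment> \<open>Prepending i would repeat a node. The suffix starting at i is itself a path
      from i and costs no more than the whole, by nonnegativity of the arc costs.\<close>
    case True
    then obtain p1 p2 where split: "p = p1 @ i # p2" by (meson split_list)
    then have "i # p2 \<in> paths_to_dest I r z i"
      using p unfolding paths_to_dest_def by (auto simp: successively_append_iff)
    then have "potential I r z i \<le> path_cost I r z (i # p2)" by (rule potential_le)
    also have "\<dots> \<le> path_cost I r z p"
      unfolding path_cost_def split
      by (rule sum_mono2) (auto simp: arc_cost_nonneg path_arcs_append[THEN subsetD])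
    finally show ?thesis using cost arc_cost_nonneg[of r z i j] by linarith
  qed
qed

text \<open>Every hub, and the origin, has a shuttle arc straight to the destination, whatever the
  design.\<close>

lemma paths_to_dest_nonempty:
  assumes "i \<in> hubs I \<or> i = orig I r \<or> i = dest I r"
  shows "paths_to_dest I r z i \<noteq> {}"
proof (cases "i = dest I r")
  case True
  then have "[i] \<in> paths_to_dest I r z i" unfolding paths_to_dest_def by auto
  then show ?thesis by auto
next
  case False
  then have "(i, dest I r) \<in> shuttle_arcs I r" using assms unfolding shuttle_arcs_def by auto
  then have "[i, dest I r] \<in> paths_to_dest I r z i"
    using False unfolding paths_to_dest_def usable_def by auto
  then show ?thesis by auto
qed

lemma potential_dest: "potential I r z (dest I r) = 0"
proof -
  have "[dest I r] \<in> paths_to_dest I r z (dest I r)" unfolding paths_to_dest_def by auto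
  then have "potential I r z (dest I r) \<le> path_cost I r z [dest I r]" by (rule potential_le)
  then show ?thesis using potential_nonneg[of r z "dest I r"] by (simp add: path_cost_def)
qed

text \<open>The shortest path from the origin is the route and its distances are u. Open legs
  satisfy the bus constraint already with v = 0, so the term z v vanishes and the dual objective is
  the distance from the origin.\<close>

lemma strong_duality:
  assumes r: "r \<in> trips I" and z: "z \<in> designs I"
  obtains w uv where "w \<in> routes I r z" "uv \<in> dual_poly I r"
    "dual_obj I r z uv = scaled_cost I r w"
proof -
  let ?o = "orig I r" and ?d = "dest I r" and ?H = "hubs I" and ?u = "potential I r z"
  obtain p where p: "p \<in> paths_to_dest I r z ?o" and cost: "?u ?o = path_cost I r z p"
    using potential_attained[of I r z ?o] paths_to_dest_nonempty[of ?o r z] by auto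
  define u where "u = (\<chi> i. ?u i)"
  \<comment> \<open>The least nonnegative v that repairs the bus constraint; it is positive only on
    legs that the potentials violate, and these turn out to be closed.\<close>
  define v where "v = (\<chi> h l. if h \<in> ?H \<and> l \<in> ?H then max 0 (?u h - ?u l - tau_hat I h l) else 0)"
  have arc: "?u i - ?u j \<le> arc_cost I r z i j" if "usable I r z i j" "j \<in> ?H \<or> j = ?o \<or> j = ?d" for i j
    using potential_arc[OF that(1) paths_to_dest_nonempty[OF that(2)]] by simp
  have shuttle: "?u i - ?u j \<le> gamma_hat I i j" if "(i, j) \<in> shuttle_arcs I r" for i j
  proof -
    have "arc_cost I r z i j \<le> gamma_hat I i j"
      using that unfolding arc_cost_def use_bus_def by auto
    moreover have "j \<in> ?H \<or> j = ?o \<or> j = ?d" using that unfolding shuttle_arcs_def by auto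
    ultimately show ?thesis using arc[of i j] that unfolding usable_def by fastforce
  qed
  have bus: "?u h - ?u l \<le> tau_hat I h l" if "h \<in> ?H" "l \<in> ?H" "z h l = 1" for h l
  proof (cases "use_bus I r z h l")
    case True
    then show ?thesis using arc[of h l] that unfolding usable_def arc_cost_def by auto
  next
    \<comment> \<open>An open leg is passed over only when a cheaper shuttle arc joins the same
      nodes, and then the shuttle bound implies the bus bound.\<close>
    case False
    then have "(h, l) \<in> shuttle_arcs I r" "gamma_hat I h l \<le> tau_hat I h l"
      using that unfolding use_bus_def by auto
    then show ?thesis using shuttle[of h l] by linarith
  qed
  have "(u, v) \<in> dual_poly I r"
    using shuttle potential_nonneg unfolding dual_poly_def u_def v_def by auto
  moreover have "dual_obj I r z (u, v) = path_cost I r z p"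
  proof -
    have "z h l * v $ h $ l = 0" if "h \<in> ?H" "l \<in> ?H" for h l
    proof -
      show ?thesis using design_entry[OF z, of h l] bus[OF that] by (auto simp: v_def)
    qed
    then have "(\<Sum>h\<in>?H. \<Sum>l\<in>?H. z h l * v $ h $ l) = 0"
      by (intro sum.neutral ballI) blast
    then show ?thesis unfolding dual_obj_def using potential_dest cost by (simp add: u_def)
  qed
  ultimately show thesis
    using that path_route_in_routes[OF orig_neq_dest[OF r] z p] scaled_cost_path_route[OF p] by metis
qed

text \<open>A dual point of equal value certifies that the route minimises the scaled objective,
  hence by the choice of M it is lexicographically optimal.\<close>

lemma scaled_optimum:
  assumes r: "r \<in> trips I" and z: "z \<in> designs I"
  obtains w uv where "optimal_route I r z w" "uv \<in> dual_poly I r"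
    "dual_obj I r z uv = scaled_cost I r w"
    "\<And>uv'. uv' \<in> dual_poly I r \<Longrightarrow> dual_obj I r z uv' \<le> scaled_cost I r w"
proof -
  obtain w uv where w: "w \<in> routes I r z" and uv: "uv \<in> dual_poly I r"
    and eq: "dual_obj I r z uv = scaled_cost I r w"
    using strong_duality[OF r z] .
  have weak: "dual_obj I r z uv' \<le> scaled_cost I r w'"
    if "uv' \<in> dual_poly I r" "w' \<in> routes I r z" for uv' w'
    using weak_duality[OF orig_neq_dest[OF r], of "fst uv'" "snd uv'" "fst w'" "snd w'" z] that
    by simp
  have "\<forall>w'\<in>routes I r z. scaled_cost I r w \<le> scaled_cost I r w'"
    using weak[OF uv] eq by simp
  then have "optimal_route I r z w"
    using scaling r z w unfolding scaling_valid_def scaled_cost_def by blast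
  then show thesis using that uv eq weak w by blast
qed

lemma bstar_eq:
  assumes "optimal_route I r z w"
  shows "bstar I r z = route_cost I r w"
  unfolding bstar_def
proof (rule the_equality)
  show "\<exists>w'. optimal_route I r z w' \<and> route_cost I r w = route_cost I r w'"
    using assms by blast
  show "b = route_cost I r w" if "\<exists>w'. optimal_route I r z w' \<and> b = route_cost I r w'" for b
    using that assms unfolding optimal_route_def by (metis less_asym)
qed

lemma fstar_eq:
  assumes "optimal_route I r z w"
  shows "fstar I r z = route_time I r w"
  unfolding fstar_def
proof (rule the_equality)
  show "\<exists>w'. optimal_route I r z w' \<and> route_time I r w = route_time I r w'"
    using assms by blast
  show "f = route_time I r w" if "\<exists>w'. optimal_route I r z w' \<and> f = route_time I r w'" for f
    using that assms unfolding optimal_route_def by (metis less_irrefl order_antisym less_trans)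
qed

lemma scaled_value_eq:
  assumes "optimal_route I r z w"
  shows "scaled_value I r z = scaled_cost I r w"
  unfolding scaled_value_def scaled_cost_def bstar_eq[OF assms] fstar_eq[OF assms] ..

lemma optimal_route_exists:
  assumes "r \<in> trips I" "z \<in> designs I"
  obtains w where "optimal_route I r z w"
  using scaled_optimum[OF assms] by blast

lemma dual_obj_le_scaled_value:
  assumes "r \<in> trips I" "z \<in> designs I" "uv \<in> dual_poly I r"
  shows "dual_obj I r z uv \<le> scaled_value I r z"
  using scaled_optimum[OF assms(1,2)] assms(3) scaled_value_eq by metis

lemma scaled_value_attained:
  assumes "r \<in> trips I" "z \<in> designs I"
  obtains uv where "uv \<in> dual_poly I r" "dual_obj I r z uv = scaled_value I r z"
  using scaled_optimum[OF assms] scaled_value_eq by metis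

text \<open>The origin of the dual space is feasible, as all scaled costs are nonnegative, and has
  objective 0.\<close>

lemma scaled_value_nonneg:
  assumes "r \<in> trips I" "z \<in> designs I"
  shows "0 \<le> scaled_value I r z"
proof -
  have "(0, 0) \<in> dual_poly I r"
    using tau_hat_nonneg gamma_hat_nonneg unfolding dual_poly_def by auto
  then have "dual_obj I r z (0, 0) \<le> scaled_value I r z"
    by (rule dual_obj_le_scaled_value[OF assms])
  then show ?thesis by (simp add: dual_obj_def)
qed

section \<open>Vertices of the dual polyhedron\<close>

text \<open>Represents \<open>dual_obj\<close> as an inner product, so that the set of optimal dual
  points is cut out by a supporting hyperplane and is a face.\<close>

definition dual_vector :: "'t \<Rightarrow> 'n mat \<Rightarrow> (real ^ 'n) \<times> (real ^ 'n ^ 'n)" where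
  "dual_vector r z = (axis (orig I r) 1 - axis (dest I r) 1,
     \<chi> h l. if h \<in> hubs I \<and> l \<in> hubs I then - z h l else 0)"

lemma dual_obj_inner: "dual_obj I r z uv = dual_vector r z \<bullet> uv"
proof -
  obtain u v where uv: "uv = (u, v)" by (cases uv)
  let ?m = "(\<chi> h l. if h \<in> hubs I \<and> l \<in> hubs I then - z h l else 0) :: real ^ 'n ^ 'n"
  have "(\<Sum>h\<in>hubs I. \<Sum>l\<in>hubs I. v $ h $ l * ?m $ h $ l) =
      (\<Sum>h\<in>UNIV. \<Sum>l\<in>UNIV. v $ h $ l * ?m $ h $ l)"
    by (rule sum_hubs_UNIV) auto
  moreover have "(\<Sum>h\<in>hubs I. \<Sum>l\<in>hubs I. v $ h $ l * ?m $ h $ l) =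
      - (\<Sum>h\<in>hubs I. \<Sum>l\<in>hubs I. z h l * v $ h $ l)"
    by (simp add: sum_negf mult.commute)
  ultimately have "?m \<bullet> v = - (\<Sum>h\<in>hubs I. \<Sum>l\<in>hubs I. z h l * v $ h $ l)"
    by (simp add: inner_vec_def mult.commute)
  moreover have "(axis (orig I r) 1 - axis (dest I r) 1) \<bullet> u = u $ orig I r - u $ dest I r"
    by (simp add: inner_diff_left inner_axis')
  ultimately show ?thesis
    unfolding uv dual_obj_def dual_vector_def by (simp add: inner_Pair)
qed

lemma dual_poly_conv:
  "dual_poly I r =
     (\<Inter>h\<in>hubs I. \<Inter>l\<in>hubs I. {uv. fst uv $ h - fst uv $ l - snd uv $ h $ l \<le> tau_hat I h l}) \<inter>
     (\<Inter>(i, j)\<in>shuttle_arcs I r. {uv. fst uv $ i - fst uv $ j \<le> gamma_hat I i j}) \<inter>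
     (\<Inter>i. {uv. 0 \<le> fst uv $ i}) \<inter>
     (\<Inter>h. \<Inter>l. {uv. if h \<in> hubs I \<and> l \<in> hubs I then 0 \<le> snd uv $ h $ l else snd uv $ h $ l = 0})"
  unfolding dual_poly_def by auto

lemma closed_dual_poly: "closed (dual_poly I r)"
proof -
  have "closed {uv :: (real ^ 'n) \<times> (real ^ 'n ^ 'n).
      if h \<in> hubs I \<and> l \<in> hubs I then 0 \<le> snd uv $ h $ l else snd uv $ h $ l = 0}" for h l
    by (cases "h \<in> hubs I \<and> l \<in> hubs I")
      (auto intro!: closed_Collect_le closed_Collect_eq continuous_intros)
  then show ?thesis
    unfolding dual_poly_conv
    by (intro closed_Int closed_INT ballI) (auto intro!: closed_Collect_le continuous_intros)
qed

lemma convex_dual_poly: "convex (dual_poly I r)"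
proof (rule convexI)
  fix p q and a b :: real
  assume p: "p \<in> dual_poly I r" and q: "q \<in> dual_poly I r" and ab: "0 \<le> a" "0 \<le> b" "a + b = 1"
  obtain u v u' v' where eq: "p = (u, v)" "q = (u', v')" by (cases p, cases q) auto
  have comb: "a * s + b * t \<le> c" if "s \<le> c" "t \<le> c" for s t c :: real
    using convex_bound_le[OF that ab] .
  have "a * (u $ h - u $ l - v $ h $ l) + b * (u' $ h - u' $ l - v' $ h $ l) \<le> tau_hat I h l"
    if "h \<in> hubs I" "l \<in> hubs I" for h l
    using p q that unfolding eq dual_poly_def by (intro comb) auto
  moreover have "a * (u $ i - u $ j) + b * (u' $ i - u' $ j) \<le> gamma_hat I i j"
    if "(i, j) \<in> shuttle_arcs I r" for i j
    using p q that unfolding eq dual_poly_def by (intro comb) auto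
  moreover have "0 \<le> a * u $ i + b * u' $ i" for i
    using p q ab unfolding eq dual_poly_def by simp
  moreover have "if h \<in> hubs I \<and> l \<in> hubs I then 0 \<le> a * v $ h $ l + b * v' $ h $ l
      else a * v $ h $ l + b * v' $ h $ l = 0" for h l
  proof -
    have "if h \<in> hubs I \<and> l \<in> hubs I then 0 \<le> v $ h $ l else v $ h $ l = 0"
      "if h \<in> hubs I \<and> l \<in> hubs I then 0 \<le> v' $ h $ l else v' $ h $ l = 0"
      using p q unfolding eq dual_poly_def by blast+
    then show ?thesis using ab by auto
  qed
  ultimately show "a *\<^sub>R p + b *\<^sub>R q \<in> dual_poly I r"
    unfolding eq dual_poly_def by (auto simp: algebra_simps)
qed

text \<open>The dual polyhedron lies in the nonnegative orthant. Among the optimal dual solutions,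
  those of least coordinate sum therefore form a compact face, which has an extreme point.\<close>

lemma optimal_dual_vertex_exists:
  assumes r: "r \<in> trips I" and z: "z \<in> designs I"
  obtains uv where "optimal_dual_vertex I r z uv"
proof -
  let ?P = "dual_poly I r" and ?a = "dual_vector r z" and ?s = "scaled_value I r z"
  define F where "F = ?P \<inter> {uv. ?a \<bullet> uv = ?s}"
  obtain uv0 where uv0: "uv0 \<in> F"
    using scaled_value_attained[OF r z] unfolding F_def dual_obj_inner by blast
  have F: "F face_of ?P"
    unfolding F_def using dual_obj_le_scaled_value[OF r z] dual_obj_inner
    by (intro face_of_Int_supporting_hyperplane_le convex_dual_poly) auto
  have "closed F" unfolding F_def
    by (intro closed_Int closed_dual_poly closed_hyperplane)
  \<comment> \<open>Pairing with the all-ones vector is the coordinate sum, which on the nonnegative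
    orthant dominates the norm.\<close>
  define e :: "(real ^ 'n) \<times> (real ^ 'n ^ 'n)" where "e = (\<chi> i. 1, \<chi> i j. 1)"
  have e: "e \<bullet> uv = (\<Sum>i\<in>UNIV. fst uv $ i) + (\<Sum>i\<in>UNIV. \<Sum>j\<in>UNIV. snd uv $ i $ j)" for uv
    by (cases uv) (simp add: e_def inner_Pair inner_vec_def)
  have nonneg: "0 \<le> fst uv $ i" "0 \<le> snd uv $ i $ j" if "uv \<in> ?P" for uv i j
  proof -
    show "0 \<le> fst uv $ i" using that unfolding dual_poly_def by auto
    have "if i \<in> hubs I \<and> j \<in> hubs I then 0 \<le> snd uv $ i $ j else snd uv $ i $ j = 0"
      using that unfolding dual_poly_def by (cases uv) auto
    then show "0 \<le> snd uv $ i $ j" by (auto split: if_splits)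
  qed
  have norm_le: "norm uv \<le> e \<bullet> uv" if "uv \<in> ?P" for uv
  proof -
    have "norm uv \<le> norm (fst uv) + norm (snd uv)"
      by (cases uv) (simp add: norm_Pair_le)
    also have "norm (fst uv) \<le> (\<Sum>i\<in>UNIV. fst uv $ i)"
      using norm_le_l1_cart[of "fst uv"] nonneg(1)[OF that] by simp
    also have "norm (snd uv) \<le> (\<Sum>i\<in>UNIV. norm (snd uv $ i))"
      unfolding norm_vec_def by (rule L2_set_le_sum) simp
    also have "\<dots> \<le> (\<Sum>i\<in>UNIV. \<Sum>j\<in>UNIV. snd uv $ i $ j)"
      using norm_le_l1_cart[of "snd uv $ _"] nonneg(2)[OF that] by (intro sum_mono) simp
    finally show ?thesis unfolding e by simp
  qed
  \<comment> \<open>Truncating F at the level of a known point makes it bounded. Points beyond that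
    level cannot be minimal, so the minimum over K is one over F.\<close>
  define K where "K = F \<inter> {uv. e \<bullet> uv \<le> e \<bullet> uv0}"
  have "compact K"
  proof (rule compact_eq_bounded_closed[THEN iffD2], rule conjI)
    show "bounded K"
      by (rule boundedI[of _ "e \<bullet> uv0"]) (use norm_le in \<open>force simp: K_def F_def\<close>)
    show "closed K"
      unfolding K_def by (intro closed_Int \<open>closed F\<close> closed_halfspace_le)
  qed
  moreover have "K \<noteq> {}" using uv0 unfolding K_def by auto
  ultimately obtain uv1 where uv1: "uv1 \<in> K" and min: "\<And>uv. uv \<in> K \<Longrightarrow> e \<bullet> uv1 \<le> e \<bullet> uv"
    using continuous_attains_inf[of K "\<lambda>uv. e \<bullet> uv"] continuous_on_inner[OF continuous_on_const continuous_on_id]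
    by blast
  have minF: "e \<bullet> uv1 \<le> e \<bullet> uv" if "uv \<in> F" for uv
  proof (cases "e \<bullet> uv \<le> e \<bullet> uv0")
    case True
    then show ?thesis using min that unfolding K_def by auto
  next
    case False
    then show ?thesis using uv1 unfolding K_def by auto
  qed
  define G where "G = F \<inter> {uv. e \<bullet> uv = e \<bullet> uv1}"
  have G: "G face_of F"
    unfolding G_def using minF face_of_imp_convex[OF F]
    by (intro face_of_Int_supporting_hyperplane_ge) auto
  \<comment> \<open>The minimal face lies inside the truncation and is therefore compact, although F
    need not be.\<close>
  have "G = K \<inter> {uv. e \<bullet> uv = e \<bullet> uv1}"
    using uv1 unfolding G_def K_def by auto
  then have "compact G"
    using \<open>compact K\<close> by (simp add: compact_Int_closed closed_hyperplane)
  moreover have "G \<noteq> {}" using uv1 unfolding G_def K_def by auto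
  ultimately obtain uv where uv: "uv extreme_point_of G"
    using extreme_point_exists_convex face_of_imp_convex[OF G] by blast
  have "uv extreme_point_of ?P" "uv \<in> F"
    using uv extreme_point_of_face[OF face_of_trans[OF G F]] unfolding G_def by auto
  then have "optimal_dual_vertex I r z uv"
    using dual_obj_le_scaled_value[OF r z] unfolding optimal_dual_vertex_def F_def dual_obj_inner by auto
  then show thesis using that by blast
qed

lemma optimal_dual_vertex_value:
  assumes "r \<in> trips I" "z \<in> designs I" "optimal_dual_vertex I r z uv"
  shows "dual_obj I r z uv = scaled_value I r z"
proof (rule order_antisym)
  have "uv \<in> dual_poly I r"
    using assms(3) unfolding optimal_dual_vertex_def extreme_point_of_def by blast
  then show "dual_obj I r z uv \<le> scaled_value I r z"
    by (rule dual_obj_le_scaled_value[OF assms(1,2)])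
  show "scaled_value I r z \<le> dual_obj I r z uv"
    using scaled_value_attained[OF assms(1,2)] assms(3) unfolding optimal_dual_vertex_def by metis
qed

end

section \<open>Validity of the cuts\<close>

text \<open>Integrality in the form that all cuts use: a counter of changed legs either reaches 1,
  which makes the cut slack, or none of the counted changes occurs.\<close>

lemma binary_sum_cases:
  fixes f :: "'a \<Rightarrow> real"
  assumes "finite S" "\<And>x. x \<in> S \<Longrightarrow> f x = 0 \<or> f x = 1"
  shows "1 \<le> sum f S \<or> sum f S = 0 \<and> (\<forall>x\<in>S. f x = 0)"
proof (cases "\<forall>x\<in>S. f x = 0")
  case False
  then obtain x where "x \<in> S" "f x = 1" using assms(2) by blast
  moreover have "f x \<le> sum f S"
    by (rule member_le_sum[OF \<open>x \<in> S\<close> _ assms(1)]) (use assms(2) in fastforce)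
  ultimately show ?thesis by simp
qed simp

context transit_network
begin

lemma num_opened_cases:
  assumes "z \<in> designs I" "z1 \<in> designs I"
  shows "1 \<le> num_opened I z1 z \<or>
    num_opened I z1 z = 0 \<and> (\<forall>h\<in>hubs I. \<forall>l\<in>hubs I. z h l \<le> z1 h l)"
proof -
  let ?S = "{(h, l) \<in> hubs I \<times> hubs I. z1 h l = 0}"
  have "z h l \<le> z1 h l" if "z1 h l = 0 \<Longrightarrow> z h l = 0" for h l
    using that design_entry[OF assms(1), of h l] design_entry[OF assms(2), of h l] by auto
  then show ?thesis
    using binary_sum_cases[of ?S "\<lambda>(h, l). z h l"] design_entry[OF assms(1)]
    unfolding num_opened_def by auto
qed

lemma num_closed_cases:
  assumes "z \<in> designs I" "z1 \<in> designs I"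
  shows "1 \<le> num_closed I z1 z \<or>
    num_closed I z1 z = 0 \<and> (\<forall>h\<in>hubs I. \<forall>l\<in>hubs I. z1 h l \<le> z h l)"
proof -
  let ?S = "{(h, l) \<in> hubs I \<times> hubs I. z1 h l = 1}"
  have "z1 h l \<le> z h l" if "z1 h l = 1 \<Longrightarrow> z h l = 1" for h l
    using that design_entry[OF assms(1), of h l] design_entry[OF assms(2), of h l] by auto
  moreover have "1 - z h l = 0 \<or> 1 - z h l = 1" for h l
    using design_entry[OF assms(1), of h l] by auto
  ultimately show ?thesis
    using binary_sum_cases[of ?S "\<lambda>(h, l). 1 - z h l"]
    unfolding num_closed_def by auto
qed

lemma num_used_closed_cases:
  assumes "z \<in> designs I"
  shows "1 \<le> num_used_closed I w z \<or>
    num_used_closed I w z = 0 \<and> (\<forall>h\<in>hubs I. \<forall>l\<in>hubs I. fst w h l = 1 \<longrightarrow> z h l = 1)"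
proof -
  let ?S = "{(h, l) \<in> hubs I \<times> hubs I. fst w h l = 1}"
  have "1 - z h l = 0 \<or> 1 - z h l = 1" for h l
    using design_entry[OF assms(1), of h l] by auto
  then show ?thesis
    using binary_sum_cases[of ?S "\<lambda>(h, l). 1 - z h l"]
    unfolding num_used_closed_def by auto
qed

lemma num_opened_same [simp]: "num_opened I z z = 0"
  unfolding num_opened_def by (auto intro: sum.neutral)

lemma num_closed_same [simp]: "num_closed I z z = 0"
  unfolding num_closed_def by (auto intro: sum.neutral)

lemma design_eqI:
  assumes "z \<in> designs I" "z1 \<in> designs I" "\<And>h l. h \<in> hubs I \<Longrightarrow> l \<in> hubs I \<Longrightarrow> z h l = z1 h l"
  shows "z = z1"
proof (intro ext)
  fix h l
  have "if h \<in> hubs I \<and> l \<in> hubs I then z h l \<in> {0, 1} else z h l = 0"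
    "if h \<in> hubs I \<and> l \<in> hubs I then z1 h l \<in> {0, 1} else z1 h l = 0"
    using assms(1,2) unfolding designs_def by blast+
  then show "z h l = z1 h l" using assms(3) by (auto split: if_splits)
qed

text \<open>The left-hand side common to (N0) and (N1) is the Hamming distance of the two
  designs.\<close>

lemma design_change:
  assumes "z \<in> designs I" "z1 \<in> designs I" "z \<noteq> z1"
  shows "1 \<le> num_opened I z1 z + num_closed I z1 z"
proof -
  have "\<not> ((\<forall>h\<in>hubs I. \<forall>l\<in>hubs I. z h l \<le> z1 h l) \<and> (\<forall>h\<in>hubs I. \<forall>l\<in>hubs I. z1 h l \<le> z h l))"
    using design_eqI[OF assms(1,2)] assms(3) by (metis order_antisym)
  then show ?thesis
    using num_opened_cases[OF assms(1,2)] num_closed_cases[OF assms(1,2)] by linarith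
qed

lemma choice_01: "choice I r z = 0 \<or> choice I r z = 1"
  unfolding choice_def by auto

text \<open>At its own design the cut agrees with the choice function. At any other design the
  Hamming distance is at least 1 and the cut is slack for every binary \<delta>.\<close>

lemma choice_cut_valid:
  assumes "z \<in> designs I" "z1 \<in> designs I"
  shows "choice_cut I r z1 z (\<lambda>r. choice I r z) b"
proof (cases "z = z1")
  case True
  then show ?thesis
    using choice_01[of r z1] by (auto simp: choice_cut_def reject_cut_def adopt_cut_def)
next
  case False
  then show ?thesis
    using design_change[OF assms] choice_01[of r z]
    by (auto simp: choice_cut_def reject_cut_def adopt_cut_def)
qed

lemma choice_cut_same:
  assumes "choice_cut I r z z \<delta> b" "\<delta> r \<in> {0, 1}"
  shows "\<delta> r = choice I r z"
  using assms choice_01[of r z] by (auto simp: choice_cut_def reject_cut_def adopt_cut_def)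

section \<open>Cost, time and shuttle distance of a route\<close>

definition shuttle_dist :: "'t \<Rightarrow> 'n route \<Rightarrow> real" where
  "shuttle_dist r w = (\<Sum>(i, j)\<in>shuttle_arcs I r. tdist I i j * snd w i j)"

text \<open>Bus legs enter the cost only through their time. Cost and weighted time thus differ by
  shuttle distance alone, which is what allows bounds on distance to become bounds on time in (V1)
  to (V3).\<close>

lemma route_cost_split:
  "route_cost I r w = weight I * route_time I r w + (1 - weight I) * shuttle_cost I * shuttle_dist r w"
proof -
  obtain x y where w: "w = (x, y)" by (cases w)
  have "(\<Sum>(i, j)\<in>shuttle_arcs I r. gamma I i j * y i j) =
      weight I * (\<Sum>(i, j)\<in>shuttle_arcs I r. ttime I i j * y i j) +
      (1 - weight I) * shuttle_cost I * (\<Sum>(i, j)\<in>shuttle_arcs I r. tdist I i j * y i j)"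
    by (simp add: sum_distrib_left sum.distrib[symmetric] case_prod_unfold gamma_def algebra_simps)
  moreover have "(\<Sum>h\<in>hubs I. \<Sum>l\<in>hubs I. tau I h l * x h l) =
      weight I * (\<Sum>h\<in>hubs I. \<Sum>l\<in>hubs I. (ttime I h l + bus_wait I) * x h l)"
    by (simp add: sum_distrib_left tau_def mult.assoc)
  ultimately show ?thesis
    unfolding w route_cost_def route_time_def shuttle_dist_def by (simp add: algebra_simps)
qed

lemma route_time_ge_shuttle:
  assumes "w \<in> routes I r z"
  shows "(\<Sum>(i, j)\<in>shuttle_arcs I r. ttime I i j * snd w i j) \<le> route_time I r w"
proof -
  obtain x y where w: "w = (x, y)" by (cases w)
  have "0 \<le> (\<Sum>h\<in>hubs I. \<Sum>l\<in>hubs I. (ttime I h l + bus_wait I) * x h l)"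
    using assms time_nonneg wait_nonneg routes_nonneg(1) unfolding w
    by (intro sum_nonneg mult_nonneg_nonneg add_nonneg_nonneg) auto
  then show ?thesis unfolding w route_time_def by simp
qed

lemma optimal_routeD:
  assumes "optimal_route I r z w" "w' \<in> routes I r z"
  shows "route_cost I r w < route_cost I r w' \<or>
    route_cost I r w = route_cost I r w' \<and> route_time I r w \<le> route_time I r w'"
  using assms unfolding optimal_route_def by blast

lemma optimal_route_in_routes: "optimal_route I r z w \<Longrightarrow> w \<in> routes I r z"
  unfolding optimal_route_def by blast

text \<open>An optimum over a larger set stays optimal over any subset that still contains
  it.\<close>

lemma fstar_restrict:
  assumes "optimal_route I r z w" "w \<in> routes I r z1" "routes I r z1 \<subseteq> routes I r z"
  shows "fstar I r z1 = fstar I r z"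
proof -
  have "optimal_route I r z1 w" using assms unfolding optimal_route_def by blast
  then show ?thesis using fstar_eq assms(1) by simp
qed

lemma fstar_le_iff_choice: "fstar I r z \<le> patience I r * cur_time I r \<longleftrightarrow> choice I r z = 1"
  unfolding choice_def by simp

text \<open>\<open>direct_route\<close> fixes only the shuttle arc and admits additional bus cycles.
  This is the trip without any bus leg, which is a route under every design.\<close>

definition plain_direct :: "'t \<Rightarrow> 'n route" where
  "plain_direct r = (\<lambda>_ _. 0, \<lambda>i j. of_bool (i = orig I r \<and> j = dest I r))"

lemma plain_direct_in_routes:
  assumes "r \<in> trips I" "z \<in> designs I"
  shows "plain_direct r \<in> routes I r z"
proof -
  have out: "(\<Sum>j\<in>UNIV. of_bool (i = orig I r \<and> j = dest I r)) = (of_bool (i = orig I r) :: real)" for i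
    by (cases "i = orig I r") (simp_all add: of_bool_def)
  have "in": "(\<Sum>j\<in>UNIV. of_bool (j = orig I r \<and> i = dest I r)) = (of_bool (i = dest I r) :: real)" for i
    by (cases "i = dest I r") (simp_all add: of_bool_def)
  have "if h \<in> hubs I \<and> l \<in> hubs I then (0 :: real) \<in> {0, 1} \<and> 0 \<le> z h l else (0 :: real) = 0" for h l
    using design_nonneg[OF assms(2)] by simp
  moreover have "if (i, j) \<in> shuttle_arcs I r then of_bool (i = orig I r \<and> j = dest I r) \<in> {0, 1 :: real}
      else of_bool (i = orig I r \<and> j = dest I r) = (0 :: real)" for i j
    by (auto simp: shuttle_arcs_def)
  moreover have "(\<Sum>j\<in>UNIV. 0 + of_bool (i = orig I r \<and> j = dest I r)) -
      (\<Sum>j\<in>UNIV. 0 + of_bool (j = orig I r \<and> i = dest I r)) =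
      (if i = orig I r then 1 else if i = dest I r then - 1 else (0 :: real))" for i
    using orig_neq_dest[OF assms(1)] by (simp only: out "in" add_0) auto
  ultimately show ?thesis
    unfolding plain_direct_def routes_def by blast
qed

lemma sum_plain_direct:
  "(\<Sum>(i, j)\<in>shuttle_arcs I r. f i j * snd (plain_direct r) i j) = f (orig I r) (dest I r)"
proof -
  have "(\<Sum>(i, j)\<in>shuttle_arcs I r. f i j * snd (plain_direct r) i j) =
      (\<Sum>(i, j)\<in>{(orig I r, dest I r)}. f i j * snd (plain_direct r) i j)"
    by (rule sum.mono_neutral_right) (auto simp: shuttle_arcs_def plain_direct_def)
  then show ?thesis by (simp add: plain_direct_def)
qed

lemma route_time_plain_direct: "route_time I r (plain_direct r) = ttime I (orig I r) (dest I r)"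
  using sum_plain_direct[of "ttime I"]
  by (simp add: route_time_def plain_direct_def case_prod_unfold)

lemma shuttle_dist_plain_direct: "shuttle_dist r (plain_direct r) = tdist I (orig I r) (dest I r)"
  unfolding shuttle_dist_def by (rule sum_plain_direct)

end

section \<open>Shuttle arcs on routes between endpoints that are not hubs\<close>

text \<open>One entry already carries the whole mass, so the remaining nonnegative entries
  vanish.\<close>

lemma binary_sum_le_1:
  fixes f g :: "'a \<Rightarrow> real"
  assumes "finite S" "\<And>x. x \<in> S \<Longrightarrow> 0 \<le> f x" "sum f S \<le> 1" "m \<in> S" "f m = 1"
  shows "(\<Sum>x\<in>S. g x * f x) = g m"
proof -
  have "sum f S = f m + sum f (S - {m})" using assms(1,4) by (rule sum.remove)
  moreover have "0 \<le> sum f (S - {m})" using assms(2) by (intro sum_nonneg) auto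
  ultimately have "sum f (S - {m}) = 0" using assms(3,5) by simp
  then have zero: "\<forall>x\<in>S - {m}. f x = 0"
    using assms(1,2) by (subst (asm) sum_nonneg_eq_0_iff) auto
  have "(\<Sum>x\<in>S. g x * f x) = g m * f m + (\<Sum>x\<in>S - {m}. g x * f x)"
    using assms(1,4) by (rule sum.remove)
  then show ?thesis using zero assms(5) by simp
qed

locale rider = transit_network I for I :: "('n::finite, 't) transit" +
  fixes r :: 't
  assumes mode_trip: "r \<in> mode_trips I"
    and orig_not_hub: "orig I r \<notin> hubs I"
    and dest_not_hub: "dest I r \<notin> hubs I"
begin

lemma trip: "r \<in> trips I"
  using mode_trip mode_trips_subset by blast

text \<open>The three groups of shuttle arcs are disjoint because neither endpoint is a hub.\<close>

lemma sum_shuttle_arcs: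
  "(\<Sum>(i, j)\<in>shuttle_arcs I r. g i j) =
     (\<Sum>h\<in>hubs I. g (orig I r) h) + (\<Sum>h\<in>hubs I. g h (dest I r)) + (g (orig I r) (dest I r) :: real)"
proof -
  let ?A = "(\<lambda>h. (orig I r, h)) ` hubs I" and ?B = "(\<lambda>h. (h, dest I r)) ` hubs I"
  have "(\<Sum>(i, j)\<in>shuttle_arcs I r. g i j) =
      (\<Sum>(i, j)\<in>?A \<union> ?B. g i j) + (\<Sum>(i, j)\<in>{(orig I r, dest I r)}. g i j)"
    unfolding shuttle_arcs_def
    by (rule sum.union_disjoint) (use orig_not_hub dest_not_hub in auto)
  also have "(\<Sum>(i, j)\<in>?A \<union> ?B. g i j) = (\<Sum>(i, j)\<in>?A. g i j) + (\<Sum>(i, j)\<in>?B. g i j)"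
    by (rule sum.union_disjoint) (use orig_not_hub dest_not_hub in auto)
  also have "(\<Sum>(i, j)\<in>?A. g i j) = (\<Sum>h\<in>hubs I. g (orig I r) h)"
    by (subst sum.reindex) (auto simp: inj_on_def)
  also have "(\<Sum>(i, j)\<in>?B. g i j) = (\<Sum>h\<in>hubs I. g h (dest I r))"
    by (subst sum.reindex) (auto simp: inj_on_def)
  finally show ?thesis by simp
qed

lemma shuttle_arcs_iff:
  "(i, j) \<in> shuttle_arcs I r \<longleftrightarrow>
     i = orig I r \<and> (j \<in> hubs I \<or> j = dest I r) \<or> j = dest I r \<and> (i \<in> hubs I \<or> i = orig I r)"
  unfolding shuttle_arcs_def by auto

text \<open>No bus leg touches an endpoint, no shuttle arc enters the origin and none leaves the
  destination. The flow equations there reduce to a single shuttle unit.\<close>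

lemma
  assumes w: "(x, y) \<in> routes I r z"
  shows outflow_orig: "(\<Sum>h\<in>hubs I. y (orig I r) h) + y (orig I r) (dest I r) = 1"
    and inflow_dest: "(\<Sum>h\<in>hubs I. y h (dest I r)) + y (orig I r) (dest I r) = 1"
proof -
  let ?o = "orig I r" and ?d = "dest I r"
  have od: "?o \<noteq> ?d" by (rule orig_neq_dest[OF trip])
  have zero: "x ?o j = 0" "x j ?o = 0" "x ?d j = 0" "x j ?d = 0" "y j ?o = 0" "y ?d j = 0" for j
    using routes_bus(3)[OF w] routes_shuttle(1)[OF w] orig_not_hub dest_not_hub od
    by (auto simp: shuttle_arcs_iff)
  have "(\<Sum>j\<in>UNIV. y ?o j) = (\<Sum>j\<in>insert ?d (hubs I). y ?o j)"
    by (rule sum.mono_neutral_right)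
      (use routes_shuttle(1)[OF w] od orig_not_hub in \<open>auto simp: shuttle_arcs_iff\<close>)
  then show "(\<Sum>h\<in>hubs I. y ?o h) + y ?o ?d = 1"
    using routes_flow[OF w, of ?o] zero dest_not_hub by simp
  have "(\<Sum>i\<in>UNIV. y i ?d) = (\<Sum>i\<in>insert ?o (hubs I). y i ?d)"
    by (rule sum.mono_neutral_right)
      (use routes_shuttle(1)[OF w] od dest_not_hub in \<open>auto simp: shuttle_arcs_iff\<close>)
  then show "(\<Sum>h\<in>hubs I. y h ?d) + y ?o ?d = 1"
    using routes_flow[OF w, of ?d] zero od orig_not_hub by simp
qed

lemma sum_direct_route:
  assumes w: "w \<in> routes I r z" and "direct_route I r w"
  shows "(\<Sum>(i, j)\<in>shuttle_arcs I r. f i j * snd w i j) = f (orig I r) (dest I r)"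
proof -
  obtain x y where xy: "w = (x, y)" by (cases w)
  let ?o = "orig I r" and ?d = "dest I r"
  have w': "(x, y) \<in> routes I r z" using w xy by simp
  have od: "y ?o ?d = 1" using assms(2) unfolding direct_route_def xy by simp
  then have "(\<Sum>h\<in>hubs I. y ?o h) = 0" "(\<Sum>h\<in>hubs I. y h ?d) = 0"
    using outflow_orig[OF w'] inflow_dest[OF w'] by auto
  then have "\<forall>h\<in>hubs I. y ?o h = 0" "\<forall>h\<in>hubs I. y h ?d = 0"
    using routes_nonneg(2)[OF w'] by (simp_all add: sum_nonneg_eq_0_iff)
  then show ?thesis using od unfolding sum_shuttle_arcs xy by simp
qed

lemma sum_hub_route:
  assumes w: "w \<in> routes I r z" and hub: "hub_route I r w m n"
  shows "(\<Sum>(i, j)\<in>shuttle_arcs I r. f i j * snd w i j) = f (orig I r) m + f n (dest I r)"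
proof -
  obtain x y where xy: "w = (x, y)" by (cases w)
  let ?o = "orig I r" and ?d = "dest I r"
  have w': "(x, y) \<in> routes I r z" using w xy by simp
  note nonneg = routes_nonneg(2)[OF w']
  have m: "m \<in> hubs I" "y ?o m = 1" and n: "n \<in> hubs I" "y n ?d = 1"
    using hub unfolding hub_route_def xy by auto
  have "y ?o m \<le> (\<Sum>h\<in>hubs I. y ?o h)"
    using m(1) by (intro member_le_sum) (auto simp: nonneg)
  then have direct: "y ?o ?d = 0"
    using outflow_orig[OF w'] nonneg[of ?o ?d] m by linarith
  have "(\<Sum>h\<in>hubs I. f ?o h * y ?o h) = f ?o m"
    using m outflow_orig[OF w'] direct by (intro binary_sum_le_1) (auto simp: nonneg)
  moreover have "(\<Sum>h\<in>hubs I. f h ?d * y h ?d) = f n ?d"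
    using n inflow_dest[OF w'] direct by (intro binary_sum_le_1) (auto simp: nonneg)
  ultimately show ?thesis using direct unfolding sum_shuttle_arcs xy by simp
qed

lemma direct_or_hub:
  assumes w: "w \<in> routes I r z"
  shows "direct_route I r w \<or> (\<exists>m n. hub_route I r w m n)"
proof (rule disjCI, rule ccontr)
  obtain x y where xy: "w = (x, y)" by (cases w)
  let ?o = "orig I r" and ?d = "dest I r"
  have w': "(x, y) \<in> routes I r z" using w xy by simp
  assume no_hub: "\<not> (\<exists>m n. hub_route I r w m n)" and "\<not> direct_route I r w"
  then have "y ?o ?d = 0"
    using routes_shuttle(2)[OF w', of ?o ?d] unfolding direct_route_def xy by auto
  then have "(\<Sum>h\<in>hubs I. y ?o h) = 1" "(\<Sum>h\<in>hubs I. y h ?d) = 1"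
    using outflow_orig[OF w'] inflow_dest[OF w'] by auto
  then have "\<exists>m\<in>hubs I. y ?o m \<noteq> 0" "\<exists>n\<in>hubs I. y n ?d \<noteq> 0"
    by (metis sum.neutral zero_neq_one)+
  then have "\<exists>m n. hub_route I r w m n"
    using routes_shuttle(2)[OF w'] unfolding hub_route_def xy by fastforce
  then show False using no_hub by blast
qed

lemma shuttle_dist_direct:
  "w \<in> routes I r z \<Longrightarrow> direct_route I r w \<Longrightarrow> shuttle_dist r w = tdist I (orig I r) (dest I r)"
  unfolding shuttle_dist_def by (rule sum_direct_route)

lemma shuttle_dist_hub:
  "w \<in> routes I r z \<Longrightarrow> hub_route I r w m n \<Longrightarrow>
    shuttle_dist r w = tdist I (orig I r) m + tdist I n (dest I r)"
  unfolding shuttle_dist_def by (rule sum_hub_route)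

lemma finite_hub_dists: "finite (hub_dists I r)"
  unfolding hub_dists_def by simp

lemma shuttle_dist_hub_bounds:
  assumes "w \<in> routes I r z" "hub_route I r w m n"
  shows "Dminus I r \<le> shuttle_dist r w" "shuttle_dist r w \<le> Dplus I r"
proof -
  have "shuttle_dist r w \<in> hub_dists I r"
    using assms(2) shuttle_dist_hub[OF assms] unfolding hub_route_def hub_dists_def by auto
  then show "Dminus I r \<le> shuttle_dist r w" "shuttle_dist r w \<le> Dplus I r"
    using finite_hub_dists unfolding Dminus_def Dplus_def by (auto simp: le_max_iff_disj)
qed

lemma shuttle_dist_le_Dplus:
  assumes "w \<in> routes I r z"
  shows "shuttle_dist r w \<le> Dplus I r"
  using direct_or_hub[OF assms]
proof (elim disjE exE)
  assume "direct_route I r w"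
  then show ?thesis using shuttle_dist_direct[OF assms] unfolding Dplus_def by simp
qed (use shuttle_dist_hub_bounds[OF assms] in blast)

lemma shuttle_weight_nonneg: "0 \<le> (1 - weight I) * shuttle_cost I"
  using weight_le_1 shuttle_cost_nonneg by simp

text \<open>By the triangle inequality, a route that is direct up to bus cycles, or that visits a single
  hub, is dominated by the direct shuttle trip. As the latter is available under every design, an
  optimal route of this kind stays optimal when bus legs are removed.\<close>

lemma plain_direct_dominates:
  assumes w: "w \<in> routes I r z" and "direct_route I r w \<or> hub_route I r w m m"
  shows "route_cost I r (plain_direct r) \<le> route_cost I r w"
    "route_time I r (plain_direct r) \<le> route_time I r w"
proof -
  have "f (orig I r) (dest I r) \<le> (\<Sum>(i, j)\<in>shuttle_arcs I r. f i j * snd w i j)"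
    if "\<And>i j k. f i k \<le> f i j + f j k" for f :: "'n \<Rightarrow> 'n \<Rightarrow> real"
    using assms(2)
  proof
    assume "direct_route I r w"
    then show ?thesis using sum_direct_route[OF w] by simp
  next
    assume "hub_route I r w m m"
    then show ?thesis using sum_hub_route[OF w] that by simp
  qed
  from this[of "tdist I", OF dist_triangle] this[of "ttime I", OF time_triangle]
  have "shuttle_dist r (plain_direct r) \<le> shuttle_dist r w"
    and time: "route_time I r (plain_direct r) \<le> route_time I r w"
    using route_time_ge_shuttle[OF w] shuttle_dist_def[of r w]
    unfolding shuttle_dist_plain_direct route_time_plain_direct by auto
  then show "route_cost I r (plain_direct r) \<le> route_cost I r w"
    unfolding route_cost_split
    by (intro add_mono mult_left_mono shuttle_weight_nonneg weight_nonneg)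
  show "route_time I r (plain_direct r) \<le> route_time I r w" by (fact time)
qed

text \<open>Any optimal route of this shape can be replaced by \<open>plain_direct\<close>, which is
  then optimal for z and still a route under z1.\<close>

lemma fstar_direct:
  assumes "optimal_route I r z w" "direct_route I r w \<or> hub_route I r w m m"
    and "z \<in> designs I" "z1 \<in> designs I" "routes I r z1 \<subseteq> routes I r z"
  shows "fstar I r z1 = fstar I r z"
proof -
  have "optimal_route I r z (plain_direct r)"
    unfolding optimal_route_def
  proof (intro conjI ballI)
    show "plain_direct r \<in> routes I r z" using plain_direct_in_routes trip assms(3) by blast
    fix w' assume "w' \<in> routes I r z"
    from optimal_routeD[OF assms(1) this]
      plain_direct_dominates[OF optimal_route_in_routes[OF assms(1)] assms(2)]
    show "route_cost I r (plain_direct r) < route_cost I r w' \<or>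
        route_cost I r (plain_direct r) = route_cost I r w' \<and>
        route_time I r (plain_direct r) \<le> route_time I r w'"
      by linarith
  qed
  then show ?thesis
    using fstar_restrict plain_direct_in_routes trip assms(4,5) by blast
qed

section \<open>Time bounds: inequalities (V1) and (V2)\<close>

lemma time_per_dist_scaled:
  assumes "0 < weight I"
  shows "(1 - weight I) * shuttle_cost I = weight I * time_per_dist I"
  using assms by (simp add: time_per_dist_def)

lemma time_per_dist_nonneg:
  assumes "0 < weight I"
  shows "0 \<le> time_per_dist I"
  using assms weight_le_1 shuttle_cost_nonneg by (simp add: time_per_dist_def)

text \<open>Cost divided by the weight is time plus distance priced in time, the unit in which both
  time bounds are stated.\<close>

lemma route_cost_time_per_dist:
  assumes "0 < weight I"
  shows "route_cost I r w = weight I * (route_time I r w + time_per_dist I * shuttle_dist r w)"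
  unfolding route_cost_split time_per_dist_scaled[OF assms] by (simp add: algebra_simps)

text \<open>The old route survives under z, so the new optimum costs no more. A longer time would
  have to be paid for by a shorter shuttle distance, and a hub route cannot go below
  \<open>Dminus\<close>.\<close>

lemma time_upper_bound:
  assumes z: "z \<in> designs I" and z1: "z1 \<in> designs I" and w: "optimal_route I r z1 w"
    and sub: "routes I r z1 \<subseteq> routes I r z"
    and adopt: "choice I r z1 = 1" and ub: "time_ub_le_threshold I r w"
  shows "choice I r z = 1"
proof -
  let ?a = "patience I r * cur_time I r" and ?c = "time_per_dist I"
  have wt: "0 < weight I" using ub unfolding time_ub_le_threshold_def by blast
  obtain w' where w': "optimal_route I r z w'" using optimal_route_exists[OF trip z] .
  note mem = optimal_route_in_routes[OF w] and mem' = optimal_route_in_routes[OF w']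
  have "fstar I r z \<le> ?a"
  proof (cases "direct_route I r w'")
    \<comment> \<open>\<open>Dminus\<close> ranges over hub pairs only and does not bound the direct
      distance. But if the new optimum is direct, the time has not changed at all.\<close>
    case True
    then show ?thesis using fstar_direct[OF w' _ z z1 sub] adopt fstar_le_iff_choice by metis
  next
    case False
    then obtain m' n' where hub': "hub_route I r w' m' n'" using direct_or_hub[OF mem'] by blast
    have "route_cost I r w' \<le> route_cost I r w"
      using optimal_routeD[OF w'] mem sub by fastforce
    then have "route_time I r w' + ?c * shuttle_dist r w' \<le> route_time I r w + ?c * shuttle_dist r w"
      using wt unfolding route_cost_time_per_dist[OF wt] by simp
    moreover have "?c * Dminus I r \<le> ?c * shuttle_dist r w'"
      using shuttle_dist_hub_bounds[OF mem' hub'] time_per_dist_nonneg[OF wt] by (simp add: mult_left_mono)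
    ultimately have "route_time I r w' \<le> route_time I r w + ?c * (shuttle_dist r w - Dminus I r)"
      by (simp add: algebra_simps)
    also have "\<dots> \<le> ?a"
      using ub shuttle_dist_direct[OF mem] shuttle_dist_hub[OF mem]
      unfolding time_ub_le_threshold_def Let_def by force
    finally show ?thesis unfolding fstar_eq[OF w'] .
  qed
  then show ?thesis using fstar_le_iff_choice by blast
qed

text \<open>The bound itself only yields a time of at least the threshold. In case of equality the two
  routes have the same cost, and the secondary objective excludes adoption.\<close>

lemma time_lower_bound:
  assumes z: "z \<in> designs I" and z1: "z1 \<in> designs I" and w: "optimal_route I r z1 w"
    and sub: "routes I r z \<subseteq> routes I r z1"
    and reject: "choice I r z1 = 0" and lb: "time_lb_ge_threshold I r w"
  shows "choice I r z = 0"
proof (cases "direct_route I r w")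
  \<comment> \<open>The direct trip is not affected by closing legs, so the time, and with it the
    rejection, is preserved.\<close>
  case True
  then have "fstar I r z = fstar I r z1" using fstar_direct[OF w _ z1 z sub] by blast
  then show ?thesis using reject unfolding choice_def by simp
next
  case False
  let ?a = "patience I r * cur_time I r" and ?c = "time_per_dist I"
  note mem = optimal_route_in_routes[OF w]
  have wt: "0 < weight I" using lb unfolding time_lb_ge_threshold_def by blast
  have t1: "?a < route_time I r w"
    using reject fstar_eq[OF w] unfolding choice_def by (auto split: if_splits)
  have lb': "?a \<le> route_time I r w + ?c * (shuttle_dist r w - Dplus I r)"
    using lb False shuttle_dist_hub[OF mem] unfolding time_lb_ge_threshold_def Let_def by force
  obtain w' where w': "optimal_route I r z w'" using optimal_route_exists[OF trip z] .
  then have mem': "w' \<in> routes I r z1" using optimal_route_in_routes sub by blast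
  show ?thesis
  proof (rule ccontr)
    assume "choice I r z \<noteq> 0"
    then have t: "route_time I r w' \<le> ?a"
      using fstar_eq[OF w'] unfolding choice_def by (auto split: if_splits)
    have "?c * shuttle_dist r w' \<le> ?c * Dplus I r"
      using shuttle_dist_le_Dplus[OF mem'] time_per_dist_nonneg[OF wt] by (rule mult_left_mono)
    then have "route_time I r w' + ?c * shuttle_dist r w' \<le> route_time I r w + ?c * shuttle_dist r w"
      using t lb' by (simp add: algebra_simps)
    then have "route_cost I r w' \<le> route_cost I r w"
      using wt unfolding route_cost_time_per_dist[OF wt] by simp
    then show False using optimal_routeD[OF w mem'] t t1 by linarith
  qed
qed

section \<open>Closest hubs and retained legs: inequalities (V3) to (V5)\<close>

text \<open>The unit reaching m by shuttle cannot continue by shuttle, since the single unit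
  entering the destination comes from n. It leaves m on a bus, and symmetrically a bus brings it to
  n.\<close>

lemma bus_leg_from:
  assumes w: "w \<in> routes I r z" and z: "z \<in> designs I"
    and hub: "hub_route I r w m n" and "m \<noteq> n"
  shows "\<exists>l\<in>hubs I. z m l = 1" "\<exists>l\<in>hubs I. z l n = 1"
proof -
  obtain x y where xy: "w = (x, y)" by (cases w)
  let ?o = "orig I r" and ?d = "dest I r"
  have w': "(x, y) \<in> routes I r z" using w xy by simp
  note nonneg = routes_nonneg[OF w']
  have m: "m \<in> hubs I" "y ?o m = 1" and n: "n \<in> hubs I" "y n ?d = 1"
    using hub unfolding hub_route_def xy by auto
  have neq: "m \<noteq> ?o" "m \<noteq> ?d" "n \<noteq> ?o" "n \<noteq> ?d"
    using m n orig_not_hub dest_not_hub by auto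
  \<comment> \<open>The endpoint flows have total 1, so m and n cannot both take a full unit from
    the origin, nor both send one to the destination.\<close>
  have le1: "y ?o m + y ?o n \<le> 1" "y m ?d + y n ?d \<le> 1"
  proof -
    have "(\<Sum>h\<in>{m, n}. y ?o h) \<le> (\<Sum>h\<in>hubs I. y ?o h)" "(\<Sum>h\<in>{m, n}. y h ?d) \<le> (\<Sum>h\<in>hubs I. y h ?d)"
      using m n nonneg by (auto intro!: sum_mono2)
    then show "y ?o m + y ?o n \<le> 1" "y m ?d + y n ?d \<le> 1"
      using outflow_orig[OF w'] inflow_dest[OF w'] nonneg(2)[of ?o ?d] \<open>m \<noteq> n\<close> by auto
  qed
  have zero: "j \<noteq> ?d \<Longrightarrow> y k j = 0" "i \<noteq> ?o \<Longrightarrow> y i k = 0" if "k \<in> hubs I" for i j k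
    using that orig_not_hub dest_not_hub
    by (auto intro!: routes_shuttle(1)[OF w'] simp: shuttle_arcs_iff)
  have "(\<Sum>j\<in>UNIV. y k j) = y k ?d" "(\<Sum>j\<in>UNIV. y j k) = y ?o k" if "k \<in> hubs I" for k
  proof -
    have "(\<Sum>j\<in>UNIV. y k j) = (\<Sum>j\<in>{?d}. y k j)"
      by (rule sum.mono_neutral_right)
        (use that zero orig_not_hub in auto)
    moreover have "(\<Sum>j\<in>UNIV. y j k) = (\<Sum>j\<in>{?o}. y j k)"
      by (rule sum.mono_neutral_right)
        (use that zero orig_not_hub in auto)
    ultimately show "(\<Sum>j\<in>UNIV. y k j) = y k ?d" "(\<Sum>j\<in>UNIV. y j k) = y ?o k" by simp_all
  qed
  then have "(\<Sum>j\<in>UNIV. x m j) - (\<Sum>j\<in>UNIV. x j m) = y ?o m - y m ?d"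
    "(\<Sum>j\<in>UNIV. x n j) - (\<Sum>j\<in>UNIV. x j n) = y ?o n - y n ?d"
    using routes_flow[OF w', of m] routes_flow[OF w', of n] m(1) n(1) neq by (simp_all add: sum.distrib)
  moreover have "0 \<le> (\<Sum>j\<in>UNIV. x j m)" "0 \<le> (\<Sum>j\<in>UNIV. x n j)"
    using nonneg by (auto intro: sum_nonneg)
  ultimately have pos: "0 < (\<Sum>j\<in>UNIV. x m j)" "0 < (\<Sum>j\<in>UNIV. x j n)"
    using le1 m(2) n(2) by linarith+
  have used: "z i j = 1 \<and> i \<in> hubs I \<and> j \<in> hubs I" if "x i j \<noteq> 0" for i j
  proof -
    have hubs: "i \<in> hubs I" "j \<in> hubs I" using that routes_bus(3)[OF w', of i j] by blast+
    then have "x i j \<le> z i j" by (rule routes_bus(2)[OF w'])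
    then show ?thesis
      using that hubs routes_bus(4)[OF w', of i j] design_entry[OF z, of i j] by auto
  qed
  have "\<exists>j. x m j \<noteq> 0" "\<exists>j. x j n \<noteq> 0"
    using pos by (metis less_irrefl sum.neutral)+
  then show "\<exists>l\<in>hubs I. z m l = 1" "\<exists>l\<in>hubs I. z l n = 1" using used by blast+
qed

lemma closest_hubs:
  assumes z: "z \<in> designs I" and conn: "weakly_connected I z" and z1: "z1 \<in> designs I"
    and w: "optimal_route I r z1 w" and sub: "routes I r z1 \<subseteq> routes I r z"
    and adopt: "choice I r z1 = 1" and closest: "closest_hub_route I r z1 w"
    and unused: "\<And>h l. h \<in> closer_from_orig I r z1 \<union> closer_to_dest I r z1 \<Longrightarrow> l \<in> hubs I \<Longrightarrow> z h l = 0"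
  shows "choice I r z = 1"
proof -
  let ?o = "orig I r" and ?d = "dest I r" and ?c = "(1 - weight I) * shuttle_cost I"
  obtain w' where w': "optimal_route I r z w'" using optimal_route_exists[OF trip z] .
  note mem = optimal_route_in_routes[OF w] and mem' = optimal_route_in_routes[OF w']
  obtain m n where hub: "hub_route I r w m n" "m \<in> active_hubs I z1" "n \<in> active_hubs I z1"
    and min: "\<And>h. h \<in> active_hubs I z1 \<Longrightarrow> tdist I ?o m \<le> tdist I ?o h"
      "\<And>h. h \<in> active_hubs I z1 \<Longrightarrow> tdist I n ?d \<le> tdist I h ?d"
    using closest unfolding closest_hub_route_def by blast
  show ?thesis
  proof (cases "direct_route I r w' \<or> (\<exists>m'. hub_route I r w' m' m')")
    case True
    then show ?thesis
      using fstar_direct[OF w' _ z z1 sub] adopt fstar_le_iff_choice by metis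
  next
    case False
    then obtain m' n' where hub': "hub_route I r w' m' n'" and neq: "m' \<noteq> n'"
      using direct_or_hub[OF mem'] by blast
    have hubs: "m' \<in> hubs I" "n' \<in> hubs I" using hub' unfolding hub_route_def by auto
    obtain l l' where l: "l \<in> hubs I" "z m' l = 1" and l': "l' \<in> hubs I" "z l' n' = 1"
      using bus_leg_from[OF mem' z hub' neq] by blast
    \<comment> \<open>The alighting hub is known only to have an incoming open leg, while the cut
      counts outgoing ones. Weak connectivity supplies an outgoing leg.\<close>
    have "1 \<le> (\<Sum>k\<in>hubs I. z k n')"
      using member_le_sum[of l' "hubs I" "\<lambda>k. z k n'"] l' design_nonneg[OF z] by simp
    then have "(\<Sum>k\<in>hubs I. z n' k) \<noteq> 0"
      using conn hubs(2) unfolding weakly_connected_def by auto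
    then obtain k where k: "k \<in> hubs I" "z n' k \<noteq> 0" by (metis sum.neutral)
    have "m' \<notin> closer_from_orig I r z1" using unused[of m' l] l by auto
    moreover have "Min (tdist I ?o ` active_hubs I z1) = tdist I ?o m"
      using hub(2) min(1) by (intro Min_eqI) auto
    ultimately have "tdist I ?o m \<le> tdist I ?o m'"
      using hubs(1) min(1) unfolding closer_from_orig_def by force
    moreover have "n' \<notin> closer_to_dest I r z1" using unused[of n' k] k by auto
    moreover have "Min ((\<lambda>h'. tdist I h' ?d) ` active_hubs I z1) = tdist I n ?d"
      using hub(3) min(2) by (intro Min_eqI) auto
    ultimately have "tdist I ?o m \<le> tdist I ?o m'" "tdist I n ?d \<le> tdist I n' ?d"
      using hubs(2) min(2) unfolding closer_to_dest_def by force+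
    then have "shuttle_dist r w \<le> shuttle_dist r w'"
      using shuttle_dist_hub[OF mem hub(1)] shuttle_dist_hub[OF mem' hub'] by simp
    then have dist: "?c * shuttle_dist r w \<le> ?c * shuttle_dist r w'"
      using shuttle_weight_nonneg by (rule mult_left_mono)
    \<comment> \<open>The lexicographic form matters: with weight 0 the cost does not see the time,
      and only the secondary objective rules out a slower route of equal cost.\<close>
    have lex: "route_cost I r w' < route_cost I r w \<or>
        route_cost I r w' = route_cost I r w \<and> route_time I r w' \<le> route_time I r w"
      using optimal_routeD[OF w'] mem sub by blast
    have "route_time I r w' \<le> route_time I r w"
    proof (rule ccontr)
      assume late: "\<not> route_time I r w' \<le> route_time I r w"
      then have "weight I * route_time I r w \<le> weight I * route_time I r w'"
        using weight_nonneg by (intro mult_left_mono) auto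
      then have "route_cost I r w \<le> route_cost I r w'"
        using dist unfolding route_cost_split by linarith
      then show False using lex late by linarith
    qed
    also have "\<dots> \<le> patience I r * cur_time I r"
      using adopt fstar_eq[OF w] fstar_le_iff_choice by metis
    finally show ?thesis using fstar_eq[OF w'] fstar_le_iff_choice by metis
  qed
qed

text \<open>No route is gained and the old optimal route keeps all its legs, so it remains
  optimal.\<close>

lemma used_legs:
  assumes z: "z \<in> designs I" and w: "optimal_route I r z1 w"
    and sub: "routes I r z \<subseteq> routes I r z1"
    and used: "\<forall>h\<in>hubs I. \<forall>l\<in>hubs I. fst w h l = 1 \<longrightarrow> z h l = 1"
  shows "choice I r z = choice I r z1"
proof -
  obtain x y where xy: "w = (x, y)" by (cases w)
  have w': "(x, y) \<in> routes I r z1" using optimal_route_in_routes[OF w] xy by simp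
  have "if h \<in> hubs I \<and> l \<in> hubs I then x h l \<in> {0, 1} \<and> x h l \<le> z h l else x h l = 0" for h l
    using routes_bus(3,4)[OF w', of h l] used design_nonneg[OF z, of h l] unfolding xy by fastforce
  moreover have "if (i, j) \<in> shuttle_arcs I r then y i j \<in> {0, 1} else y i j = 0" for i j
    using routes_shuttle[OF w'] by metis
  ultimately have "w \<in> routes I r z"
    using routes_flow[OF w'] unfolding xy routes_def by blast
  then have "fstar I r z = fstar I r z1" using fstar_restrict[OF w _ sub] by blast
  then show ?thesis unfolding choice_def by simp
qed

lemma strengthening_cut_valid:
  assumes z: "z \<in> designs I" and conn: "weakly_connected I z" and z1: "z1 \<in> designs I"
    and w: "optimal_route I r z1 w" and c: "c \<in> strengthening_cuts I r z1 w"
  shows "c z (\<lambda>r. choice I r z) b"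
proof -
  have closed: "1 \<le> num_closed I z1 z \<or> num_closed I z1 z = 0 \<and> routes I r z1 \<subseteq> routes I r z"
    using num_closed_cases[OF z z1] routes_mono[of I z1 z r] by blast
  have opened: "1 \<le> num_opened I z1 z \<or> num_opened I z1 z = 0 \<and> routes I r z \<subseteq> routes I r z1"
    using num_opened_cases[OF z z1] routes_mono[of I z z1 r] by blast
  note used = num_used_closed_cases[OF z, of w]
  have choice: "choice I r z = 0 \<or> choice I r z = 1" by (rule choice_01)
  consider
      (V1) "choice I r z1 = 1" "time_ub_le_threshold I r w"
        "c = (\<lambda>z \<delta> b. num_closed I z1 z + \<delta> r \<ge> 1)"
    | (V2) "choice I r z1 = 0" "time_lb_ge_threshold I r w"
        "c = (\<lambda>z \<delta> b. num_opened I z1 z \<ge> \<delta> r)"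
    | (V3) "choice I r z1 = 1" "closest_hub_route I r z1 w"
        "c = (\<lambda>z \<delta> b. (\<Sum>h\<in>closer_from_orig I r z1 \<union> closer_to_dest I r z1. \<Sum>l\<in>hubs I. z h l) +
            num_closed I z1 z + \<delta> r \<ge> 1)"
    | (V4) "choice I r z1 = 1"
        "c = (\<lambda>z \<delta> b. num_used_closed I w z + num_opened I z1 z + \<delta> r \<ge> 1)"
    | (V5) "choice I r z1 = 0"
        "c = (\<lambda>z \<delta> b. num_used_closed I w z + num_opened I z1 z \<ge> \<delta> r)"
    using c unfolding strengthening_cuts_def by blast
  then show ?thesis
  proof cases
    case V1
    then show ?thesis using closed time_upper_bound[OF z z1 w] choice by auto
  next
    case V2
    then show ?thesis using opened time_lower_bound[OF z z1 w] choice by auto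
  next
    case V3
    let ?W = "closer_from_orig I r z1 \<union> closer_to_dest I r z1"
    let ?s = "\<Sum>h\<in>?W. \<Sum>l\<in>hubs I. z h l"
    have s: "?s = (\<Sum>(h, l)\<in>?W \<times> hubs I. z h l)"
      by (rule sum.cartesian_product)
    have "1 \<le> ?s \<or> ?s = 0 \<and> (\<forall>h\<in>?W. \<forall>l\<in>hubs I. z h l = 0)"
      using binary_sum_cases[of "?W \<times> hubs I" "\<lambda>(h, l). z h l"] design_entry[OF z]
      unfolding s by auto
    then show ?thesis
      using V3 closed closest_hubs[OF z conn z1 w _ V3(1,2)] choice by auto
  next
    case V4
    then show ?thesis using opened used used_legs[OF z w] choice by auto
  next
    case V5
    then show ?thesis using opened used used_legs[OF z w] choice by auto
  qed
qed

end

section \<open>The relaxed master problem\<close>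

context transit_network
begin

definition connected_designs :: "'n mat set" where
  "connected_designs = {z \<in> designs I. weakly_connected I z}"

lemma connected_designsD:
  assumes "z \<in> connected_designs"
  shows "z \<in> designs I" "weakly_connected I z"
  using assms unfolding connected_designs_def by auto

lemma finite_designs: "finite (designs I)"
proof (rule finite_subset)
  show "designs I \<subseteq> (\<lambda>S h l. of_bool ((h, l) \<in> S)) ` (UNIV :: ('n \<times> 'n) set set)"
  proof
    fix z assume z: "z \<in> designs I"
    have "z = (\<lambda>h l. of_bool ((h, l) \<in> {(h, l). z h l = 1}))"
    proof (intro ext)
      fix h l
      show "z h l = of_bool ((h, l) \<in> {(h, l). z h l = 1})" using design_entry[OF z, of h l] by auto
    qed
    then show "z \<in> (\<lambda>S h l. of_bool ((h, l) \<in> S)) ` (UNIV :: ('n \<times> 'n) set set)" by blast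
  qed
qed simp

lemma finite_connected_designs: "finite connected_designs"
  unfolding connected_designs_def using finite_designs by simp

text \<open>The empty design keeps the relaxed master problem feasible and ensures that there is a
  candidate at all.\<close>

lemma zero_connected: "(\<lambda>_ _. 0) \<in> connected_designs"
  unfolding connected_designs_def designs_def weakly_connected_def by simp

lemma finite_mode_trips: "finite (mode_trips I)"
  using finite_trips mode_trips_subset by (rule rev_finite_subset)

lemma design_cost_zero: "design_cost I (\<lambda>_ _. 0) = 0"
  by (simp add: design_cost_def)

text \<open>The second conjunct records that a cut is either an optimality cut or reads only z and
  the \<delta> of mode trips. It permits b to be altered freely as long as the optimality cuts are
  respected.\<close>

definition sound_cut :: "('n, 't) cut \<Rightarrow> bool" where
  "sound_cut c \<longleftrightarrow>
     (\<forall>z\<in>connected_designs. c z (\<lambda>r. choice I r z) (\<lambda>r. scaled_value I r z)) \<and>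
     ((\<exists>r\<in>trips I. \<exists>w. w extreme_point_of dual_poly I r \<and> c = optimality_cut I r w) \<or>
      (\<forall>z \<delta> \<delta>' b b'. (\<forall>r\<in>mode_trips I. \<delta> r = \<delta>' r) \<longrightarrow> c z \<delta> b = c z \<delta>' b'))"

lemma optimality_cut_valid:
  assumes "r \<in> trips I" "w extreme_point_of dual_poly I r" "z \<in> designs I"
  shows "optimality_cut I r w z \<delta> (\<lambda>r. scaled_value I r z)"
  using dual_obj_le_scaled_value[OF assms(1,3)] assms(2)
  unfolding optimality_cut_def extreme_point_of_def by blast

lemma sound_optimality_cut:
  assumes "r \<in> trips I" "w extreme_point_of dual_poly I r"
  shows "sound_cut (optimality_cut I r w)"
  using assms optimality_cut_valid connected_designsD(1) unfolding sound_cut_def by blast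

lemma sound_choice_cut:
  assumes "r \<in> mode_trips I" "z1 \<in> designs I"
  shows "sound_cut (choice_cut I r z1)"
  using assms choice_cut_valid connected_designsD(1) unfolding sound_cut_def
  by (auto simp: choice_cut_def reject_cut_def adopt_cut_def)

lemma sound_strengthening_cut:
  assumes r: "r \<in> mode_trips I" and z1: "z1 \<in> designs I" and w: "optimal_route I r z1 w"
    and c: "c \<in> strengthening_cuts I r z1 w"
  shows "sound_cut c"
proof -
  have not_hubs: "orig I r \<notin> hubs I" "dest I r \<notin> hubs I"
    using c unfolding strengthening_cuts_def by auto
  interpret rider I r by unfold_locales (use r not_hubs in auto)
  have "c z (\<lambda>r. choice I r z) b" if "z \<in> connected_designs" for z b
    using strengthening_cut_valid[OF connected_designsD[OF that] z1 w c] .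
  moreover have "c z \<delta> b = c z \<delta>' b'" if "\<forall>r\<in>mode_trips I. \<delta> r = \<delta>' r" for z \<delta> \<delta>' b b'
    using c that r unfolding strengthening_cuts_def by auto
  ultimately show ?thesis unfolding sound_cut_def by blast
qed

text \<open>The inequalities on \<nu> linearise \<nu> = \<delta> b, which is consistent here since
  the scaled value lies between 0 and its upper bound.\<close>

lemma induced_rmp_feasible:
  assumes C: "\<forall>c\<in>C. sound_cut c" and z: "z \<in> connected_designs"
  shows "(z, \<lambda>r. choice I r z, \<lambda>r. scaled_value I r z, \<lambda>r. choice I r z * scaled_value I r z)
    \<in> rmp_feasible I C"
proof -
  note zd = connected_designsD[OF z]
  have "0 \<le> scaled_value I r z" "scaled_value I r z \<le> bigMr I r" if "r \<in> mode_trips I" for r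
    using that mode_trips_subset scaled_value_nonneg zd(1) bound unfolding bound_valid_def by auto
  moreover have "c z (\<lambda>r. choice I r z) (\<lambda>r. scaled_value I r z)" if "c \<in> C" for c
    using C that z unfolding sound_cut_def by blast
  ultimately show ?thesis
    using zd unfolding rmp_feasible_def choice_def by auto
qed

lemma rmp_obj_induced:
  "rmp_obj I (z, \<lambda>r. choice I r z, \<lambda>r. scaled_value I r z, \<lambda>r. choice I r z * scaled_value I r z) =
    candidate_value I z"
  unfolding rmp_obj_def candidate_value_def by (simp add: algebra_simps)

lemma rmp_value_le_candidate:
  assumes "\<forall>c\<in>C. sound_cut c" "z \<in> connected_designs"
  shows "rmp_value I C \<le> ereal (candidate_value I z)"
  unfolding rmp_value_def rmp_obj_induced[of z, symmetric]
  by (rule INF_lower) (rule induced_rmp_feasible[OF assms])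

lemma rmp_feasibleD:
  assumes "(z, \<delta>, b, \<nu>) \<in> rmp_feasible I C"
  shows "z \<in> connected_designs" "\<forall>r\<in>mode_trips I. \<delta> r \<in> {0, 1}"
    "\<forall>r\<in>mode_trips I. \<nu> r \<le> bigMr I r * \<delta> r \<and> \<nu> r \<le> b r \<and>
       \<nu> r \<ge> b r - bigMr I r * (1 - \<delta> r) \<and> \<nu> r \<ge> 0"
    "\<forall>c\<in>C. c z \<delta> b"
  using assms unfolding rmp_feasible_def connected_designs_def by auto

lemma rmp_feasible_mono: "C \<subseteq> C' \<Longrightarrow> rmp_feasible I C' \<subseteq> rmp_feasible I C"
  unfolding rmp_feasible_def by auto

text \<open>For an adopting rider the linearisation gives \<nu> \<ge> b, for a rejecting one \<nu>
  \<ge> 0; correct choices and sufficiently large b thus cost at least the candidate value.\<close>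

lemma candidate_le_rmp_obj:
  assumes feas: "(z, \<delta>, b, \<nu>) \<in> rmp_feasible I C"
    and choice: "\<forall>r\<in>mode_trips I. \<delta> r = choice I r z"
    and b: "\<forall>r\<in>trips I. scaled_value I r z \<le> b r"
  shows "candidate_value I z \<le> rmp_obj I (z, \<delta>, b, \<nu>)"
proof -
  have "choice I r z * (scaled_value I r z - net_price I) \<le> \<nu> r - \<delta> r * net_price I"
    if r: "r \<in> mode_trips I" for r
  proof (cases "choice I r z = 0")
    case True
    then show ?thesis using rmp_feasibleD(3)[OF feas] choice r by auto
  next
    case False
    then have "\<delta> r = 1" "choice I r z = 1" using choice_01[of r z] choice r by auto
    moreover have "scaled_value I r z \<le> b r" using b r mode_trips_subset by blast
    moreover have "\<nu> r \<ge> b r - bigMr I r * (1 - \<delta> r)" using rmp_feasibleD(3)[OF feas] r by blast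
    ultimately show ?thesis by simp
  qed
  then have "(\<Sum>r\<in>mode_trips I. real (riders I r) * (choice I r z * (scaled_value I r z - net_price I)))
      \<le> (\<Sum>r\<in>mode_trips I. real (riders I r) * (\<nu> r - \<delta> r * net_price I))"
    by (intro sum_mono mult_left_mono) auto
  moreover have "(\<Sum>r\<in>trips I - mode_trips I. real (riders I r) * scaled_value I r z)
      \<le> (\<Sum>r\<in>trips I - mode_trips I. real (riders I r) * b r)"
    using b by (intro sum_mono mult_left_mono) auto
  ultimately show ?thesis
    unfolding rmp_obj_def candidate_value_def by (simp add: mult.assoc)
qed

text \<open>Lowering \<open>b\<close> to the supremum of its cuts and \<open>\<nu>\<close> to \<open>\<delta> b\<close> improves every point of the
  relaxed master problem, and only finitely many points of this form exist.\<close>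

lemma rmp_attained:
  assumes C: "\<forall>c\<in>C. sound_cut c"
    and priced: "\<And>r. r \<in> trips I - mode_trips I \<Longrightarrow> riders I r \<noteq> 0 \<Longrightarrow>
      \<exists>w. w extreme_point_of dual_poly I r \<and> optimality_cut I r w \<in> C"
  shows "\<exists>p\<in>rmp_feasible I C. rmp_value I C = ereal (rmp_obj I p)"
proof -
  define L where
    "L r z = {dual_obj I r z w |w. w extreme_point_of dual_poly I r \<and> optimality_cut I r w \<in> C}" for r z
  \<comment> \<open>For mode trips 0 is inserted because 0 \<le> \<nu> \<le> b forces b \<ge> 0. For
    the others a default replaces the supremum of an empty set; by \<open>priced\<close> this can
    only happen when the trip has no riders.\<close>
  define b0 where "b0 z r = (if r \<in> mode_trips I then Sup (insert 0 (L r z))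
    else if L r z = {} then 0 else Sup (L r z))" for z r
  \<comment> \<open>Feasibility leaves \<delta> and \<nu> arbitrary outside the mode trips, so they
    are reset to 0 to leave finitely many points.\<close>
  define N :: "('n, 't) rmp_point \<Rightarrow> ('n, 't) rmp_point" where
    "N = (\<lambda>(z, \<delta>, b, \<nu>). (z, \<lambda>r. if r \<in> mode_trips I then \<delta> r else 0, b0 z,
      \<lambda>r. (if r \<in> mode_trips I then \<delta> r else 0) * b0 z r))"
  have L_le: "t \<le> scaled_value I r z" if "r \<in> trips I" "z \<in> designs I" "t \<in> L r z" for r z t
    using that dual_obj_le_scaled_value unfolding L_def extreme_point_of_def by blast
  have bdd: "bdd_above (L r z)" if "r \<in> trips I" "z \<in> designs I" for r z
    using L_le[OF that] by (rule bdd_aboveI)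
  have b0_ge: "t \<le> b0 z r" if "r \<in> trips I" "z \<in> designs I" "t \<in> L r z" for r z t
    using that bdd[OF that(1,2)] unfolding b0_def by (auto intro: cSup_upper)
  have b0_nonneg: "0 \<le> b0 z r" if "r \<in> mode_trips I" "z \<in> designs I" for r z
  proof -
    have "bdd_above (insert 0 (L r z))" using that bdd[of r z] mode_trips_subset by auto
    then show ?thesis using that cSup_upper[of 0 "insert 0 (L r z)"] unfolding b0_def by simp
  qed
  have b0_le: "b0 z r \<le> bigMr I r" if "r \<in> mode_trips I" "z \<in> designs I" for r z
  proof -
    have r: "r \<in> trips I" using that(1) mode_trips_subset by blast
    have "b0 z r \<le> scaled_value I r z"
      using that(1) L_le[OF r that(2)] scaled_value_nonneg[OF r that(2)]
      unfolding b0_def by (auto intro!: cSup_least)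
    also have "\<dots> \<le> bigMr I r" using bound that unfolding bound_valid_def by blast
    finally show ?thesis .
  qed
  have N: "N p \<in> rmp_feasible I C \<and> rmp_obj I (N p) \<le> rmp_obj I p" if p: "p \<in> rmp_feasible I C" for p
  proof -
    obtain z \<delta> b \<nu> where eq: "p = (z, \<delta>, b, \<nu>)" by (cases p)
    note feas = rmp_feasibleD[OF p[unfolded eq]]
    note zd = connected_designsD[OF feas(1)]
    have "c z (\<lambda>r. if r \<in> mode_trips I then \<delta> r else 0) (b0 z)" if c: "c \<in> C" for c
    proof (cases "\<exists>r\<in>trips I. \<exists>w. w extreme_point_of dual_poly I r \<and> c = optimality_cut I r w")
      case True
      then obtain r w where r: "r \<in> trips I" "w extreme_point_of dual_poly I r" "c = optimality_cut I r w"
        by blast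
      then have "dual_obj I r z w \<in> L r z" using c unfolding L_def by blast
      then have "dual_obj I r z w \<le> b0 z r" by (rule b0_ge[OF r(1) zd(1)])
      then show ?thesis by (simp add: r(3) optimality_cut_def)
    next
      case False
      then have indep: "\<forall>z \<delta> \<delta>' b b'. (\<forall>r\<in>mode_trips I. \<delta> r = \<delta>' r) \<longrightarrow> c z \<delta> b = c z \<delta>' b'"
        using C c unfolding sound_cut_def by blast
      have "c z \<delta> b = c z (\<lambda>r. if r \<in> mode_trips I then \<delta> r else 0) (b0 z)"
        by (rule indep[rule_format]) simp
      moreover have "c z \<delta> b" using feas(4) c by blast
      ultimately show ?thesis by (rule iffD1)
    qed
    moreover have "\<delta> r * b0 z r \<le> bigMr I r * \<delta> r \<and> \<delta> r * b0 z r \<le> b0 z r \<and>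
        \<delta> r * b0 z r \<ge> b0 z r - bigMr I r * (1 - \<delta> r) \<and> \<delta> r * b0 z r \<ge> 0"
      if "r \<in> mode_trips I" for r
      using b0_nonneg[OF that zd(1)] b0_le[OF that zd(1)] feas(2) that by auto
    ultimately have "N p \<in> rmp_feasible I C"
      using zd feas(2) unfolding eq N_def rmp_feasible_def by auto
    moreover have "rmp_obj I (N p) \<le> rmp_obj I p"
    proof -
      have L_b: "t \<le> b r" if "t \<in> L r z" for r t
        using that feas(4) unfolding L_def optimality_cut_def by auto
      have "real (riders I r) * b0 z r \<le> real (riders I r) * b r" if r: "r \<in> trips I - mode_trips I" for r
      proof (cases "riders I r = 0")
        case False
        then have "L r z \<noteq> {}" using priced[OF r] unfolding L_def by blast
        then have "b0 z r \<le> b r" using r L_b unfolding b0_def by (auto intro!: cSup_least)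
        then show ?thesis by (intro mult_left_mono) auto
      qed simp
      moreover have "\<delta> r * b0 z r \<le> \<nu> r" if r: "r \<in> mode_trips I" for r
      proof (cases "\<delta> r = 0")
        case False
        then have one: "\<delta> r = 1" using feas(2) r by auto
        \<comment> \<open>With \<delta> = 1 the linearisation pins \<nu> to b, and \<nu> \<ge> 0
          makes b an upper bound also of the inserted 0.\<close>
        then have "b r \<le> \<nu> r" "0 \<le> b r" using feas(3) r by fastforce+
        moreover have "b0 z r \<le> b r" using r L_b \<open>0 \<le> b r\<close> unfolding b0_def by (auto intro!: cSup_least)
        ultimately show ?thesis using one by simp
      qed (use feas(3) r in auto)
      then have "real (riders I r) * ((if r \<in> mode_trips I then \<delta> r else 0) * b0 z r -
            (if r \<in> mode_trips I then \<delta> r else 0) * net_price I)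
          \<le> real (riders I r) * (\<nu> r - \<delta> r * net_price I)" if "r \<in> mode_trips I" for r
        using that by (intro mult_left_mono) auto
      ultimately show ?thesis
        unfolding eq N_def rmp_obj_def prod.case
        by (intro add_mono sum_mono order_refl) blast+
    qed
    ultimately show ?thesis by blast
  qed
  have "N ` rmp_feasible I C \<subseteq> (\<lambda>(z, A). (z, \<lambda>r. of_bool (r \<in> A), b0 z, \<lambda>r. of_bool (r \<in> A) * b0 z r)) `
      (designs I \<times> Pow (mode_trips I))"
  proof
    fix q assume "q \<in> N ` rmp_feasible I C"
    then obtain z \<delta> b \<nu> where p: "(z, \<delta>, b, \<nu>) \<in> rmp_feasible I C" and q: "q = N (z, \<delta>, b, \<nu>)"
      by (metis imageE prod_cases4)
    define A where "A = {r \<in> mode_trips I. \<delta> r = 1}"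
    have "(if r \<in> mode_trips I then \<delta> r else 0) = of_bool (r \<in> A)" for r
      using rmp_feasibleD(2)[OF p] unfolding A_def by auto
    then have "q = (z, \<lambda>r. of_bool (r \<in> A), b0 z, \<lambda>r. of_bool (r \<in> A) * b0 z r)"
      by (simp only: q N_def prod.case)
    moreover have "(z, A) \<in> designs I \<times> Pow (mode_trips I)"
      using connected_designsD(1)[OF rmp_feasibleD(1)[OF p]] unfolding A_def by auto
    ultimately show "q \<in> (\<lambda>(z, A). (z, \<lambda>r. of_bool (r \<in> A), b0 z, \<lambda>r. of_bool (r \<in> A) * b0 z r)) `
        (designs I \<times> Pow (mode_trips I))"
      by (intro image_eqI[of _ _ "(z, A)"]) auto
  qed
  then have "finite (N ` rmp_feasible I C)"
    by (rule finite_subset) (intro finite_imageI finite_cartesian_product finite_designs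
      finite_Pow_iff[THEN iffD2] finite_mode_trips)
  then have fin: "finite (rmp_obj I ` N ` rmp_feasible I C)" by (rule finite_imageI)
  have "rmp_feasible I C \<noteq> {}" using induced_rmp_feasible[OF C zero_connected] by blast
  then have "Min (rmp_obj I ` N ` rmp_feasible I C) \<in> rmp_obj I ` N ` rmp_feasible I C"
    using fin by (intro Min_in) auto
  then obtain p where p: "p \<in> rmp_feasible I C"
    and min: "Min (rmp_obj I ` N ` rmp_feasible I C) = rmp_obj I (N p)" by auto
  have "rmp_obj I (N p) \<le> rmp_obj I q" if "q \<in> rmp_feasible I C" for q
  proof -
    have "rmp_obj I (N p) \<le> rmp_obj I (N q)" unfolding min[symmetric] using that fin by (intro Min_le) auto
    then show ?thesis using N[OF that] by linarith
  qed
  then have "rmp_value I C = ereal (rmp_obj I (N p))"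
    unfolding rmp_value_def using N[OF p] by (intro antisym INF_lower INF_greatest) auto
  moreover have "N p \<in> rmp_feasible I C" using N[OF p] ..
  ultimately show ?thesis by (rule bexI)
qed

text \<open>Without cuts, b is free below on trips outside the mode trips. Either none of them has
  riders and the minimum is attained, or the value is minus infinity and every feasible point is
  accepted.\<close>

lemma rmp_initial_solution: "\<exists>p. rmp_solution I {} p"
proof (cases "\<forall>r\<in>trips I - mode_trips I. riders I r = 0")
  case True
  then have "\<exists>p\<in>rmp_feasible I {}. rmp_value I {} = ereal (rmp_obj I p)"
    by (intro rmp_attained) auto
  then obtain p where "p \<in> rmp_feasible I {}" "rmp_value I {} = ereal (rmp_obj I p)" by blast
  then have "rmp_solution I {} p" unfolding rmp_solution_def by simp
  then show ?thesis by blast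
next
  case False
  then obtain r0 where r0: "r0 \<in> trips I - mode_trips I" "riders I r0 \<noteq> 0" by blast
  \<comment> \<open>Nothing is opened, nobody adopts, and the single free coordinate t drives the
    objective to any prescribed value.\<close>
  define p :: "real \<Rightarrow> ('n, 't) rmp_point" where
    "p t = (\<lambda>_ _. 0, \<lambda>_. 0, \<lambda>r. if r = r0 then t else 0, \<lambda>_. 0)" for t
  have nonneg: "0 \<le> bigMr I r" if "r \<in> mode_trips I" for r
    using that bound scaled_value_nonneg[of r] mode_trips_subset connected_designsD(1)[OF zero_connected]
    unfolding bound_valid_def by (meson order_trans subsetD)
  have p: "p t \<in> rmp_feasible I {}" for t
    using connected_designsD[OF zero_connected] r0(1) nonneg unfolding p_def rmp_feasible_def by auto
  have obj: "rmp_obj I (p t) = real (riders I r0) * t" for t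
  proof -
    have "(\<Sum>r\<in>trips I - mode_trips I. real (riders I r) * (if r = r0 then t else 0)) =
        (\<Sum>r\<in>trips I - mode_trips I. if r = r0 then real (riders I r0) * t else 0)"
      by (intro sum.cong) auto
    then show ?thesis
      using r0(1) finite_trips by (simp add: p_def rmp_obj_def design_cost_zero)
  qed
  have "rmp_value I {} \<le> ereal K" for K
  proof -
    have "rmp_value I {} \<le> ereal (rmp_obj I (p (K / real (riders I r0))))"
      unfolding rmp_value_def by (rule INF_lower) (rule p)
    then show ?thesis using r0(2) unfolding obj by simp
  qed
  then have "rmp_value I {} = - \<infinity>" by (rule ereal_bot)
  then have "rmp_solution I {} (p 0)" using p unfolding rmp_solution_def by simp
  then show ?thesis by blast
qed

end

section \<open>Termination and correctness\<close>

context transit_network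
begin

definition priced :: "('n, 't) cut set \<Rightarrow> bool" where
  "priced C \<longleftrightarrow> (\<forall>r\<in>trips I. \<exists>w. w extreme_point_of dual_poly I r \<and> optimality_cut I r w \<in> C)"

lemma rmp_attained_priced:
  assumes "\<forall>c\<in>C. sound_cut c" "priced C"
  shows "\<exists>p\<in>rmp_feasible I C. rmp_value I C = ereal (rmp_obj I p)"
  using assms by (intro rmp_attained) (auto simp: priced_def)

definition invariant :: "('n, 't) state \<Rightarrow> bool" where
  "invariant s \<longleftrightarrow> (\<forall>c\<in>cuts s. sound_cut c) \<and> (cuts s = {} \<or> priced (cuts s)) \<and>
     (\<forall>z\<in>connected_designs. lower s \<le> ereal (candidate_value I z)) \<and>
     (incumbent s = None \<and> upper s = \<infinity> \<or>
      (\<exists>z\<in>connected_designs. incumbent s = Some z \<and> upper s = ereal (candidate_value I z)))"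

text \<open>What an iteration at \<open>z\<close>, \<open>\<delta>\<close> achieves: as soon as its cuts are present, revisiting the same
  pair costs at least the candidate value of \<open>z\<close>.\<close>

definition visits :: "('n, 't) state \<Rightarrow> ('n, 't) state \<Rightarrow> 'n mat \<Rightarrow> ('t \<Rightarrow> real) \<Rightarrow> bool" where
  "visits s s' z \<delta> \<longleftrightarrow> z \<in> connected_designs \<and> (\<forall>r\<in>mode_trips I. \<delta> r \<in> {0, 1}) \<and>
     cuts s \<subseteq> cuts s' \<and> priced (cuts s') \<and> upper s' \<le> ereal (candidate_value I z) \<and>
     (priced (cuts s) \<longrightarrow>
       (\<exists>b \<nu>. (z, \<delta>, b, \<nu>) \<in> rmp_feasible I (cuts s) \<and> lower s' = ereal (rmp_obj I (z, \<delta>, b, \<nu>)))) \<and>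
     (\<forall>\<delta>' b \<nu>. (z, \<delta>', b, \<nu>) \<in> rmp_feasible I (cuts s') \<longrightarrow> (\<forall>r\<in>mode_trips I. \<delta>' r = \<delta> r) \<longrightarrow>
       candidate_value I z \<le> rmp_obj I (z, \<delta>', b, \<nu>))"

lemma invariant_init: "invariant init_state"
  unfolding invariant_def init_state_def by simp

text \<open>A repeated choice vector that was wrong violates its own choice cut. One that was right
  meets the optimality cuts at the optimal dual vertices, which hold b at or above the scaled
  values.\<close>

lemma iteration_step:
  assumes inv: "invariant s" and it: "iteration I \<epsilon> s s'"
  shows "invariant s' \<and> (\<exists>z \<delta>. visits s s' z \<delta>)"
proof -
  obtain z \<delta> b \<nu> W R where
    sol: "rmp_solution I (cuts s) (z, \<delta>, b, \<nu>)" and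
    W: "\<forall>r\<in>trips I. optimal_dual_vertex I r z (W r)" and
    R: "\<forall>r\<in>mode_trips I. optimal_route I r z (R r)" and
    lower: "lower s' = rmp_value I (cuts s)" and
    cuts: "cuts s' = cuts s \<union> {optimality_cut I r (W r) | r. r \<in> trips I}
      \<union> {choice_cut I r z | r. r \<in> mode_trips I \<and> \<delta> r \<noteq> choice I r z}
      \<union> (\<Union>r\<in>mode_trips I. strengthening_cuts I r z (R r))" and
    upper: "if ereal (candidate_value I z) < upper s
      then upper s' = ereal (candidate_value I z) \<and> incumbent s' = Some z
      else upper s' = upper s \<and> incumbent s' = incumbent s"
    using it unfolding iteration_def by (elim conjE exE) (rule that)
  have sound: "\<forall>c\<in>cuts s. sound_cut c" using inv unfolding invariant_def by blast
  have feas: "(z, \<delta>, b, \<nu>) \<in> rmp_feasible I (cuts s)" using sol unfolding rmp_solution_def by blast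
  have z: "z \<in> connected_designs" and \<delta>: "\<forall>r\<in>mode_trips I. \<delta> r \<in> {0, 1}"
    using rmp_feasibleD[OF feas] by blast+
  note zd = connected_designsD[OF z]
  have Wext: "W r extreme_point_of dual_poly I r" if "r \<in> trips I" for r
    using W that unfolding optimal_dual_vertex_def by blast
  have priced': "priced (cuts s')"
    unfolding priced_def cuts using Wext by blast
  have "sound_cut c" if "c \<in> cuts s'" for c
    using that sound Wext sound_optimality_cut sound_choice_cut[OF _ zd(1)]
      sound_strengthening_cut[OF _ zd(1)] R unfolding cuts by blast
  moreover have "\<forall>z\<in>connected_designs. lower s' \<le> ereal (candidate_value I z)"
    unfolding lower using rmp_value_le_candidate[OF sound] by blast
  moreover have "incumbent s' = None \<and> upper s' = \<infinity> \<or>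
      (\<exists>z\<in>connected_designs. incumbent s' = Some z \<and> upper s' = ereal (candidate_value I z))"
    using upper inv z unfolding invariant_def by (auto split: if_splits)
  ultimately have inv': "invariant s'" using priced' unfolding invariant_def by blast
  have "upper s' \<le> ereal (candidate_value I z)" using upper by (auto split: if_splits)
  \<comment> \<open>Once priced, the value is attained and hence finite, so a returned solution is a
    true minimiser.\<close>
  moreover have "lower s' = ereal (rmp_obj I (z, \<delta>, b, \<nu>))" if "priced (cuts s)"
    using sol rmp_attained_priced[OF sound that] unfolding lower rmp_solution_def by auto
  moreover have "candidate_value I z \<le> rmp_obj I (z, \<delta>', b', \<nu>')"
    if p: "(z, \<delta>', b', \<nu>') \<in> rmp_feasible I (cuts s')" and same: "\<forall>r\<in>mode_trips I. \<delta>' r = \<delta> r"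
    for \<delta>' b' \<nu>'
  proof (rule candidate_le_rmp_obj[OF p])
    show "\<forall>r\<in>mode_trips I. \<delta>' r = choice I r z"
    proof (rule ballI, rule ccontr)
      fix r assume r: "r \<in> mode_trips I" and neq: "\<delta>' r \<noteq> choice I r z"
      then have "choice_cut I r z \<in> cuts s'" using same unfolding cuts by auto
      then have "choice_cut I r z z \<delta>' b'" using rmp_feasibleD(4)[OF p] by blast
      then have "\<delta>' r = choice I r z"
        by (rule choice_cut_same) (use rmp_feasibleD(2)[OF p] r in blast)
      then show False using neq by blast
    qed
    show "\<forall>r\<in>trips I. scaled_value I r z \<le> b' r"
    proof
      fix r assume r: "r \<in> trips I"
      then have "optimality_cut I r (W r) z \<delta>' b'" using rmp_feasibleD(4)[OF p] unfolding cuts by blast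
      then show "scaled_value I r z \<le> b' r"
        using optimal_dual_vertex_value[OF r zd(1)] W r unfolding optimality_cut_def by simp
    qed
  qed
  ultimately have "visits s s' z \<delta>"
    using z \<delta> feas priced' unfolding visits_def cuts by blast
  then show ?thesis using inv' by blast
qed

lemma reachable_invariant:
  assumes "reachable I \<epsilon> s"
  shows "invariant s"
  using assms unfolding reachable_def
  by (induction rule: rtranclp_induct) (use invariant_init iteration_step in blast)+

lemma iteration_exists:
  assumes inv: "invariant s" and run: "running \<epsilon> s"
  shows "\<exists>s'. iteration I \<epsilon> s s'"
proof -
  have sound: "\<forall>c\<in>cuts s. sound_cut c" using inv unfolding invariant_def by blast
  have "\<exists>p. rmp_solution I (cuts s) p"
  proof (cases "cuts s = {}")
    case True
    then show ?thesis using rmp_initial_solution by simp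
  next
    case False
    then have "priced (cuts s)" using inv unfolding invariant_def by blast
    then obtain p where "p \<in> rmp_feasible I (cuts s)" "rmp_value I (cuts s) = ereal (rmp_obj I p)"
      using rmp_attained_priced[OF sound] by blast
    then have "rmp_solution I (cuts s) p" unfolding rmp_solution_def by simp
    then show ?thesis by blast
  qed
  then obtain z \<delta> b \<nu> where sol: "rmp_solution I (cuts s) (z, \<delta>, b, \<nu>)" by (metis prod_cases4)
  then have z: "z \<in> designs I"
    using rmp_feasibleD(1) connected_designsD(1) unfolding rmp_solution_def by blast
  have "\<exists>W. \<forall>r\<in>trips I. optimal_dual_vertex I r z (W r)"
    using optimal_dual_vertex_exists z by (intro bchoice) blast
  then obtain W where W: "\<forall>r\<in>trips I. optimal_dual_vertex I r z (W r)" ..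
  have "\<exists>R. \<forall>r\<in>mode_trips I. optimal_route I r z (R r)"
    using optimal_route_exists z mode_trips_subset by (intro bchoice) blast
  then obtain R where R: "\<forall>r\<in>mode_trips I. optimal_route I r z (R r)" ..
  define s' :: "('n, 't) state" where "s' = \<lparr>lower = rmp_value I (cuts s),
    upper = (if ereal (candidate_value I z) < upper s then ereal (candidate_value I z) else upper s),
    incumbent = (if ereal (candidate_value I z) < upper s then Some z else incumbent s),
    cuts = cuts s \<union> {optimality_cut I r (W r) | r. r \<in> trips I}
      \<union> {choice_cut I r z | r. r \<in> mode_trips I \<and> \<delta> r \<noteq> choice I r z}
      \<union> (\<Union>r\<in>mode_trips I. strengthening_cuts I r z (R r))\<rparr>"
  have "iteration I \<epsilon> s s'"
    unfolding iteration_def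
    by (intro conjI run exI[of _ z] exI[of _ \<delta>] exI[of _ b] exI[of _ \<nu>] exI[of _ W] exI[of _ R] sol W R)
      (simp_all add: s'_def)
  then show ?thesis by blast
qed

text \<open>The first iteration adds an optimality cut for every trip, so that the relaxed master problem
  attains its value from then on. In an infinite run some pair of a design and a choice vector is
  visited twice, and at the second visit the bounds meet.\<close>

lemma no_infinite_run:
  assumes \<epsilon>: "0 \<le> \<epsilon>"
  shows "\<not> (\<exists>S. S 0 = init_state \<and> (\<forall>k. iteration I \<epsilon> (S k) (S (Suc k))))"
proof
  assume "\<exists>S. S 0 = init_state \<and> (\<forall>k. iteration I \<epsilon> (S k) (S (Suc k)))"
  then obtain S where S0: "S 0 = init_state" and it: "\<And>k. iteration I \<epsilon> (S k) (S (Suc k))" by blast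
  have inv: "invariant (S k)" for k
    by (induction k) (use S0 invariant_init iteration_step it in \<open>simp, blast\<close>)
  have "\<forall>k. \<exists>p. visits (S k) (S (Suc k)) (fst p) (snd p)"
    using iteration_step[OF inv it] by simp
  then obtain p where "\<forall>k. visits (S k) (S (Suc k)) (fst (p k)) (snd (p k))"
    by (rule choice[THEN exE])
  then obtain z \<delta> where visits: "\<And>k. visits (S k) (S (Suc k)) (z k) (\<delta> k)"
    by (metis comp_apply)
  \<comment> \<open>The pigeonhole is applied to the set of adopting mode trips, since \<delta>
    itself is arbitrary elsewhere and may take infinitely many values.\<close>
  define f where "f k = (z k, {r \<in> mode_trips I. \<delta> k r = 1})" for k
  have "finite (designs I \<times> Pow (mode_trips I))"
    using finite_designs finite_mode_trips by simp
  moreover have "range f \<subseteq> designs I \<times> Pow (mode_trips I)"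
    using visits connected_designsD(1) unfolding f_def visits_def by blast
  ultimately have "\<not> inj f"
    using finite_imageD[of f UNIV] finite_subset infinite_UNIV_nat by blast
  then obtain i k where "i \<noteq> k" "f i = f k" unfolding inj_on_def by blast
  then obtain i k where ik: "i < k" "f i = f k" by (metis nat_neq_iff)
  have mono: "cuts (S i) \<subseteq> cuts (S j)" if "i \<le> j" for i j
    using lift_Suc_mono_le[of "\<lambda>k. cuts (S k)" i j] visits that unfolding visits_def by blast
  \<comment> \<open>The later index k is positive, so an iteration precedes it; the initial state
    has no cuts.\<close>
  have "priced (cuts (S k))"
    using visits[of "k - 1"] ik(1) unfolding visits_def by simp
  then obtain b \<nu> where feas: "(z k, \<delta> k, b, \<nu>) \<in> rmp_feasible I (cuts (S k))"
    and lower: "lower (S (Suc k)) = ereal (rmp_obj I (z k, \<delta> k, b, \<nu>))"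
    using visits[of k] unfolding visits_def by blast
  have "z k = z i" using ik(2) unfolding f_def by simp
  moreover have "\<forall>r\<in>mode_trips I. \<delta> k r = \<delta> i r"
  proof
    fix r assume r: "r \<in> mode_trips I"
    then have "\<delta> k r \<in> {0, 1}" "\<delta> i r \<in> {0, 1}" using visits unfolding visits_def by blast+
    moreover have "\<delta> k r = 1 \<longleftrightarrow> \<delta> i r = 1" using ik(2) r unfolding f_def by auto
    ultimately show "\<delta> k r = \<delta> i r" by auto
  qed
  moreover have "(z k, \<delta> k, b, \<nu>) \<in> rmp_feasible I (cuts (S (Suc i)))"
    using feas rmp_feasible_mono[OF mono[of "Suc i" k]] ik(1) by auto
  ultimately have "candidate_value I (z k) \<le> rmp_obj I (z k, \<delta> k, b, \<nu>)"
    using visits[of i] unfolding visits_def by metis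
  moreover have "upper (S (Suc k)) \<le> ereal (candidate_value I (z k))"
    using visits[of k] unfolding visits_def by blast
  ultimately have "upper (S (Suc k)) \<le> lower (S (Suc k))"
    unfolding lower by (meson ereal_less_eq(3) order_trans)
  also have "\<dots> \<le> lower (S (Suc k)) + ereal \<epsilon>"
    using \<epsilon> unfolding lower by simp
  finally have "\<not> running \<epsilon> (S (Suc k))" unfolding running_def by simp
  moreover have "running \<epsilon> (S (Suc k))" using it[of "Suc k"] unfolding iteration_def by (rule conjunct1)
  ultimately show False by blast
qed

section \<open>Problem (E) as minimisation of the candidate value over connected designs\<close>

text \<open>The choice cut at z itself pins \<delta> to the choice function, and the vertex cut at a
  dual optimum for z bounds b below by the scaled value.\<close>

lemma candidate_le_E_obj:
  assumes "E_feasible I (z, \<delta>, b)"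
  shows "z \<in> connected_designs" "candidate_value I z \<le> E_obj I (z, \<delta>, b)"
proof -
  have feas: "z \<in> designs I" "weakly_connected I z" "\<forall>r\<in>mode_trips I. \<delta> r \<in> {0, 1}"
    "\<forall>r\<in>mode_trips I. \<forall>z1\<in>designs I. choice I r z1 = 0 \<longrightarrow> reject_cut I r z1 z \<delta> b"
    "\<forall>r\<in>mode_trips I. \<forall>z1\<in>designs I. choice I r z1 = 1 \<longrightarrow> adopt_cut I r z1 z \<delta> b"
    "\<forall>r\<in>trips I. \<forall>w. w extreme_point_of dual_poly I r \<longrightarrow> optimality_cut I r w z \<delta> b"
    using assms unfolding E_feasible_def by auto
  show "z \<in> connected_designs" using feas(1,2) unfolding connected_designs_def by blast
  have \<delta>: "\<delta> r = choice I r z" if "r \<in> mode_trips I" for r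
    using that feas(1,3,4,5) choice_01[of r z] choice_cut_same[of r z \<delta> b] unfolding choice_cut_def by auto
  have b: "scaled_value I r z \<le> b r" if r: "r \<in> trips I" for r
  proof -
    obtain w where w: "optimal_dual_vertex I r z w"
      using optimal_dual_vertex_exists[OF r feas(1)] .
    then have "optimality_cut I r w z \<delta> b" using feas(6) r unfolding optimal_dual_vertex_def by blast
    then show ?thesis
      using optimal_dual_vertex_value[OF r feas(1) w] unfolding optimality_cut_def by simp
  qed
  have "(\<Sum>r\<in>mode_trips I. real (riders I r) * choice I r z * (scaled_value I r z - net_price I))
      \<le> (\<Sum>r\<in>mode_trips I. real (riders I r) * \<delta> r * (b r - net_price I))"
  proof (rule sum_mono)
    fix r assume r: "r \<in> mode_trips I"
    have "0 \<le> real (riders I r) * choice I r z" using choice_01[of r z] by auto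
    moreover have "scaled_value I r z - net_price I \<le> b r - net_price I"
      using b r mode_trips_subset by auto
    ultimately show "real (riders I r) * choice I r z * (scaled_value I r z - net_price I)
        \<le> real (riders I r) * \<delta> r * (b r - net_price I)"
      unfolding \<delta>[OF r] by (rule mult_left_mono[rotated])
  qed
  moreover have "(\<Sum>r\<in>trips I - mode_trips I. real (riders I r) * scaled_value I r z)
      \<le> (\<Sum>r\<in>trips I - mode_trips I. real (riders I r) * b r)"
    using b by (intro sum_mono mult_left_mono) auto
  ultimately show "candidate_value I z \<le> E_obj I (z, \<delta>, b)"
    unfolding candidate_value_def E_obj_def by simp
qed

lemma induced_solution_feasible:
  assumes z: "z \<in> connected_designs"
  shows "E_feasible I (induced_solution I z)"
proof -
  note zd = connected_designsD[OF z]
  have cut: "choice_cut I r z1 z (\<lambda>r. choice I r z) (\<lambda>r. scaled_value I r z)" if "z1 \<in> designs I" for r z1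
    using choice_cut_valid[OF zd(1) that] .
  have "choice I r z \<in> {0, 1}" for r using choice_01[of r z] by blast
  moreover have "reject_cut I r z1 z (\<lambda>r. choice I r z) (\<lambda>r. scaled_value I r z)"
    if "z1 \<in> designs I" "choice I r z1 = 0" for r z1
    using cut[of z1 r] that unfolding choice_cut_def by simp
  moreover have "adopt_cut I r z1 z (\<lambda>r. choice I r z) (\<lambda>r. scaled_value I r z)"
    if "z1 \<in> designs I" "choice I r z1 = 1" for r z1
    using cut[of z1 r] that unfolding choice_cut_def by simp
  ultimately show ?thesis
    using zd optimality_cut_valid[OF _ _ zd(1)] unfolding E_feasible_def induced_solution_def by auto
qed

lemma E_obj_induced_solution: "E_obj I (induced_solution I z) = candidate_value I z"
  unfolding E_obj_def induced_solution_def candidate_value_def by simp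

text \<open>The upper bound is the value of the incumbent and the lower bound lies below every
  candidate, so stopping compares the two within \<epsilon>.\<close>

lemma terminated_incumbent:
  assumes "reachable I \<epsilon> s" "\<not> running \<epsilon> s"
  obtains zs where "incumbent s = Some zs" "zs \<in> connected_designs"
    "\<And>z. z \<in> connected_designs \<Longrightarrow> candidate_value I zs \<le> candidate_value I z + \<epsilon>"
proof -
  have inv: "invariant s" by (rule reachable_invariant[OF assms(1)])
  have stop: "upper s \<le> lower s + ereal \<epsilon>" using assms(2) unfolding running_def by simp
  have upper: "upper s \<le> ereal (candidate_value I z + \<epsilon>)" if "z \<in> connected_designs" for z
  proof -
    have "lower s + ereal \<epsilon> \<le> ereal (candidate_value I z) + ereal \<epsilon>"
      using inv that unfolding invariant_def by (intro add_right_mono) blast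
    then show ?thesis using stop by simp
  qed
  \<comment> \<open>Finiteness of the upper bound is what excludes termination without an
    incumbent.\<close>
  then have "upper s \<noteq> \<infinity>" using zero_connected by fastforce
  then obtain zs where zs: "zs \<in> connected_designs" "incumbent s = Some zs"
    "upper s = ereal (candidate_value I zs)"
    using inv unfolding invariant_def by blast
  then show thesis using that upper by simp
qed

lemma returns_optimal_within:
  "returns I \<epsilon> (\<lambda>z. \<exists>zs. z = Some zs \<and> E_optimal_within \<epsilon> I (induced_solution I zs))"
  unfolding returns_def
proof (intro allI impI, elim conjE)
  fix s assume "reachable I \<epsilon> s" "\<not> running \<epsilon> s"
  then obtain zs where zs: "incumbent s = Some zs" "zs \<in> connected_designs"
    "\<And>z. z \<in> connected_designs \<Longrightarrow> candidate_value I zs \<le> candidate_value I z + \<epsilon>"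
    by (rule terminated_incumbent) (rule that)
  have "E_obj I (induced_solution I zs) \<le> E_obj I w + \<epsilon>" if "E_feasible I w" for w
  proof -
    obtain z \<delta> b where w: "w = (z, \<delta>, b)" by (cases w)
    show ?thesis
      using candidate_le_E_obj[OF that[unfolded w]] zs(3)[of z] unfolding E_obj_induced_solution w by linarith
  qed
  then have "E_optimal_within \<epsilon> I (induced_solution I zs)"
    using induced_solution_feasible[OF zs(2)] unfolding E_optimal_within_def by blast
  then show "\<exists>zs. incumbent s = Some zs \<and> E_optimal_within \<epsilon> I (induced_solution I zs)"
    using zs(1) by blast
qed

lemma returns_optimal:
  "\<exists>\<epsilon>0>0. \<forall>\<epsilon>. 0 \<le> \<epsilon> \<and> \<epsilon> < \<epsilon>0 \<longrightarrow>
     returns I \<epsilon> (\<lambda>z. \<exists>zs. z = Some zs \<and> E_optimal I (induced_solution I zs))"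
proof -
  let ?V = "candidate_value I ` connected_designs"
  define opt where "opt = Min ?V"
  \<comment> \<open>The smallest excess of a suboptimal candidate value; the inserted 1 keeps the
    minimum defined when all candidates have the same value.\<close>
  define \<epsilon>0 where "\<epsilon>0 = Min (insert 1 ((\<lambda>v. v - opt) ` (?V - {opt})))"
  have fin: "finite ?V" using finite_connected_designs by simp
  have opt: "opt \<in> ?V" unfolding opt_def using fin zero_connected by (intro Min_in) auto
  have le: "opt \<le> candidate_value I z" if "z \<in> connected_designs" for z
    unfolding opt_def using fin that by (intro Min_le) auto
  have "0 < \<epsilon>0"
    unfolding \<epsilon>0_def using fin le by (subst Min_gr_iff) (auto simp: order_less_le)
  moreover have "returns I \<epsilon> (\<lambda>z. \<exists>zs. z = Some zs \<and> E_optimal I (induced_solution I zs))"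
    if \<epsilon>: "0 \<le> \<epsilon>" "\<epsilon> < \<epsilon>0" for \<epsilon>
    unfolding returns_def
  proof (intro allI impI, elim conjE)
    fix s assume "reachable I \<epsilon> s" "\<not> running \<epsilon> s"
    then obtain zs where zs: "incumbent s = Some zs" "zs \<in> connected_designs"
      "\<And>z. z \<in> connected_designs \<Longrightarrow> candidate_value I zs \<le> candidate_value I z + \<epsilon>"
      by (rule terminated_incumbent) (rule that)
    have "candidate_value I zs = opt"
    proof (rule ccontr)
      assume neq: "candidate_value I zs \<noteq> opt"
      have "\<epsilon>0 \<le> candidate_value I zs - opt"
        unfolding \<epsilon>0_def using fin zs(2) neq by (intro Min_le) auto
      moreover have "candidate_value I zs \<le> opt + \<epsilon>" using opt zs(3) by auto
      ultimately show False using \<epsilon>(2) by linarith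
    qed
    then have "E_obj I (induced_solution I zs) \<le> E_obj I w" if "E_feasible I w" for w
      using candidate_le_E_obj[of "fst w" "fst (snd w)" "snd (snd w)"] that le[of "fst w"]
      unfolding E_obj_induced_solution by simp
    then have "E_optimal I (induced_solution I zs)"
      using induced_solution_feasible[OF zs(2)] unfolding E_optimal_def by blast
    then show "\<exists>zs. incumbent s = Some zs \<and> E_optimal I (induced_solution I zs)"
      using zs(1) by blast
  qed
  ultimately show ?thesis by blast
qed

lemma algorithm_terminates: "0 \<le> \<epsilon> \<Longrightarrow> terminates I \<epsilon>"
  unfolding terminates_def using iteration_exists reachable_invariant no_infinite_run by blast

end

theorem proposition9:
  fixes I :: "('n::finite, 't) transit"
  assumes "valid_data I"
    and "scaling_valid I"
    and "bound_valid I"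
  shows "(\<forall>\<epsilon>\<ge>0. terminates I \<epsilon> \<and>
            returns I \<epsilon> (\<lambda>z. \<exists>zs. z = Some zs \<and> E_optimal_within \<epsilon> I (induced_solution I zs))) \<and>
         (\<exists>\<epsilon>0>0. \<forall>\<epsilon>. 0 \<le> \<epsilon> \<and> \<epsilon> < \<epsilon>0 \<longrightarrow>
            returns I \<epsilon> (\<lambda>z. \<exists>zs. z = Some zs \<and> E_optimal I (induced_solution I zs)))"
proof -
  interpret transit_network I by unfold_locales (fact assms)+
  show ?thesis
    using algorithm_terminates returns_optimal_within returns_optimal by blast
qed

end
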